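(* Let $(M,\langle\cdot,\cdot\rangle)$ be a Riemannian 3-manifold without boundary with constant nonzero scalar curvature, let $U\subseteq M$ be open, and let $k$ be a smooth, hypersurface-orthogonal unit vector field on $U$. Then $k$ is 2-principal, i.e. $R(k,\cdot,\cdot,\cdot)=0$ on $U$, if and only if $k$ is a Killing vector field on $U$.
   Context: $\nabla$ is the Levi-Civita connection, and the Riemann 4-tensor is $R(u,v,w,z)=\langle\nabla_u\nabla_v w-\nabla_v\nabla_u w-\nabla_{[u,v]}w,\,z\rangle$. For a non-flat Riemannian 3-manifold, a smooth unit vector field $k$ on an open subset is called 2-principal if $R(k,\cdot,\cdot,\cdot)=0$. The field $k$ is hypersurface-orthogonal if at every point of its domain $\omega=\langle\nabla_y k,x\rangle-\langle\nabla_x k,y\rangle$ vanishes, where $\{k,x,y\}$ is any local orthonormal frame (equivalently, the plane field $k^\perp$ is integrable). *)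

theory Defs
  imports "HOL-Analysis.Analysis" "HOL-Library.Function_Algebras"
begin

section \<open>Smooth functions on open subsets of a Euclidean space\<close>

text \<open>Only meant for open \<open>S\<close>.\<close>

primrec Ck_on :: "nat \<Rightarrow> ('e::euclidean_space \<Rightarrow> 'f::real_normed_vector) \<Rightarrow> 'e set \<Rightarrow> bool" where
  "Ck_on 0 = (\<lambda>f S. continuous_on S f)"
| "Ck_on (Suc k) = (\<lambda>f S. (\<forall>x\<in>S. f differentiable (at x)) \<and>
     (\<forall>v. Ck_on k (\<lambda>x. frechet_derivative f (at x) v) S))"

definition smooth_on :: "('e::euclidean_space \<Rightarrow> 'f::real_normed_vector) \<Rightarrow> 'e set \<Rightarrow> bool" where
  "smooth_on f S \<longleftrightarrow> (\<forall>k. Ck_on k f S)"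


section \<open>Smooth manifolds\<close>

text \<open>A chart is a pair of an open domain and a coordinate map into the model space \<open>'e\<close>; the values
  of the coordinate map outside the domain are irrelevant. The dimension is \<open>DIM('e)\<close>. Charts
  have open images in \<open>'e\<close>, so there is no boundary.\<close>

type_synonym ('a, 'e) chart = "'a set \<times> ('a \<Rightarrow> 'e)"

record ('a, 'e) manifold =
  mtop :: "'a topology"
  atlas :: "('a, 'e) chart set"

definition is_chart :: "'a topology \<Rightarrow> ('a, 'e::euclidean_space) chart \<Rightarrow> bool" where
  "is_chart X = (\<lambda>(D, \<phi>). openin X D \<and> open (\<phi> ` D) \<and>
     homeomorphic_map (subtopology X D) (top_of_set (\<phi> ` D)) \<phi>)"

definition smooth_manifold :: "('a, 'e::euclidean_space) manifold \<Rightarrow> bool" where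
  "smooth_manifold M \<longleftrightarrow>
     Hausdorff_space (mtop M) \<and> second_countable (mtop M) \<and>
     (\<forall>c\<in>atlas M. is_chart (mtop M) c) \<and>
     (\<Union>(D, \<phi>)\<in>atlas M. D) = topspace (mtop M) \<and>
     (\<forall>(D, \<phi>)\<in>atlas M. \<forall>(D', \<phi>')\<in>atlas M.
        smooth_on (\<phi>' \<circ> inv_into D \<phi>) (\<phi> ` (D \<inter> D')))"

text \<open>Real functions and vector fields are total functions on \<open>'a\<close>. For those "on \<open>W\<close>" (always an
  open set) only the values on \<open>W\<close> matter.\<close>

definition smooth_fun :: "('a, 'e::euclidean_space) manifold \<Rightarrow> 'a set \<Rightarrow> ('a \<Rightarrow> real) \<Rightarrow> bool" where
  "smooth_fun M W f \<longleftrightarrow>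
     (\<forall>(D, \<phi>)\<in>atlas M. smooth_on (f \<circ> inv_into D \<phi>) (\<phi> ` (D \<inter> W)))"

definition smooth_near :: "('a, 'e::euclidean_space) manifold \<Rightarrow> 'a \<Rightarrow> ('a \<Rightarrow> real) \<Rightarrow> bool" where
  "smooth_near M p f \<longleftrightarrow> (\<exists>W. openin (mtop M) W \<and> p \<in> W \<and> smooth_fun M W f)"


section \<open>Tangent vectors and vector fields\<close>

text \<open>Tangent vectors at \<open>p\<close> are the derivations at \<open>p\<close> of the functions that are smooth near \<open>p\<close>.
  They are set to 0 on all other functions, so that equality of tangent vectors is equality in HOL.
  That a derivation depends only on the germ of \<open>f\<close> at \<open>p\<close> follows from the Leibniz rule: if \<open>f\<close>
  vanishes near \<open>p\<close>, then \<open>f = \<chi> * f\<close> where \<open>\<chi>\<close> is 0 near \<open>p\<close> and 1 elsewhere, and \<open>\<chi>\<close> is smooth near \<open>p\<close>.\<close>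

type_synonym 'a tangent = "('a \<Rightarrow> real) \<Rightarrow> real"
type_synonym 'a vfield = "'a \<Rightarrow> 'a tangent"

definition tangent_space :: "('a, 'e::euclidean_space) manifold \<Rightarrow> 'a \<Rightarrow> 'a tangent set" where
  "tangent_space M p = {v.
     (\<forall>f h. smooth_near M p f \<longrightarrow> smooth_near M p h \<longrightarrow>
        v (f + h) = v f + v h \<and> v (f * h) = v f * h p + f p * v h) \<and>
     (\<forall>a f. smooth_near M p f \<longrightarrow> v (\<lambda>q. a * f q) = a * v f) \<and>
     (\<forall>f. \<not> smooth_near M p f \<longrightarrow> v f = 0)}"

text \<open>\<open>dird u f\<close> is the function usually written \<open>u f\<close> (or \<open>df(u)\<close>).\<close>

definition dird :: "'a vfield \<Rightarrow> ('a \<Rightarrow> real) \<Rightarrow> 'a \<Rightarrow> real" where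
  "dird u f = (\<lambda>p. u p f)"

definition vector_field :: "('a, 'e::euclidean_space) manifold \<Rightarrow> 'a set \<Rightarrow> 'a vfield \<Rightarrow> bool" where
  "vector_field M W u \<longleftrightarrow>
     (\<forall>p\<in>W. u p \<in> tangent_space M p) \<and>
     (\<forall>V f. openin (mtop M) V \<longrightarrow> V \<subseteq> W \<longrightarrow> smooth_fun M V f \<longrightarrow> smooth_fun M V (dird u f))"

text \<open>Addition and subtraction of vector fields are pointwise, by the instances for function types.\<close>

definition vscale :: "('a \<Rightarrow> real) \<Rightarrow> 'a vfield \<Rightarrow> 'a vfield" where
  "vscale f u = (\<lambda>p h. f p * u p h)"

definition bracket :: "('a, 'e::euclidean_space) manifold \<Rightarrow> 'a vfield \<Rightarrow> 'a vfield \<Rightarrow> 'a vfield" where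
  "bracket M u v = (\<lambda>p f. if smooth_near M p f then u p (dird v f) - v p (dird u f) else 0)"


section \<open>Riemannian metrics and the Levi-Civita connection\<close>

type_synonym 'a metric_tensor = "'a \<Rightarrow> 'a tangent \<Rightarrow> 'a tangent \<Rightarrow> real"
type_synonym 'a connection = "'a vfield \<Rightarrow> 'a vfield \<Rightarrow> 'a vfield"

definition ip :: "'a metric_tensor \<Rightarrow> 'a vfield \<Rightarrow> 'a vfield \<Rightarrow> 'a \<Rightarrow> real" where
  "ip g u v = (\<lambda>p. g p (u p) (v p))"

definition riemannian_metric :: "('a, 'e::euclidean_space) manifold \<Rightarrow> 'a metric_tensor \<Rightarrow> bool" where
  "riemannian_metric M g \<longleftrightarrow>
     (\<forall>p\<in>topspace (mtop M).
        (\<forall>u\<in>tangent_space M p. \<forall>v\<in>tangent_space M p. g p u v = g p v u) \<and>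
        (\<forall>u\<in>tangent_space M p. \<forall>v\<in>tangent_space M p. \<forall>w\<in>tangent_space M p.
           g p (u + v) w = g p u w + g p v w) \<and>
        (\<forall>a. \<forall>u\<in>tangent_space M p. \<forall>v\<in>tangent_space M p.
           g p (\<lambda>f. a * u f) v = a * g p u v) \<and>
        (\<forall>u\<in>tangent_space M p. u \<noteq> 0 \<longrightarrow> g p u u > 0)) \<and>
     (\<forall>W u v. openin (mtop M) W \<longrightarrow> vector_field M W u \<longrightarrow> vector_field M W v \<longrightarrow>
        smooth_fun M W (ip g u v))"

text \<open>A connection acts on the smooth vector fields on every open set \<open>W\<close>. Since the axioms are
  required for every \<open>W\<close> and constrain values on \<open>W\<close> only, \<open>nabla u v p\<close> depends only on the germs
  of \<open>u\<close> and \<open>v\<close> at \<open>p\<close>: if, say, \<open>v\<close> vanishes near \<open>p\<close>, write \<open>v = vscale \<chi> v\<close> with \<open>\<chi>\<close> as for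
  tangent vectors. So this is a connection in the usual sense, together with its restrictions.\<close>

definition affine_connection ::
  "('a, 'e::euclidean_space) manifold \<Rightarrow> 'a connection \<Rightarrow> bool" where
  "affine_connection M nabla \<longleftrightarrow>
     (\<forall>W u v w f. openin (mtop M) W \<longrightarrow> vector_field M W u \<longrightarrow> vector_field M W v \<longrightarrow>
        vector_field M W w \<longrightarrow> smooth_fun M W f \<longrightarrow>
        vector_field M W (nabla u v) \<and>
        (\<forall>p\<in>W.
           nabla (u + v) w p = nabla u w p + nabla v w p \<and>
           nabla (vscale f u) v p = vscale f (nabla u v) p \<and>
           nabla u (v + w) p = nabla u v p + nabla u w p \<and>
           nabla u (vscale f v) p = vscale (dird u f) v p + vscale f (nabla u v) p))"

definition levi_civita ::
  "('a, 'e::euclidean_space) manifold \<Rightarrow> 'a metric_tensor \<Rightarrow> 'a connection \<Rightarrow> bool" where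
  "levi_civita M g nabla \<longleftrightarrow> affine_connection M nabla \<and>
     (\<forall>W u v w. openin (mtop M) W \<longrightarrow> vector_field M W u \<longrightarrow> vector_field M W v \<longrightarrow>
        vector_field M W w \<longrightarrow>
        (\<forall>p\<in>W.
           nabla u v p - nabla v u p = bracket M u v p \<and>
           dird u (ip g v w) p = ip g (nabla u v) w p + ip g v (nabla u w) p))"


section \<open>Curvature\<close>

definition riemann ::
  "('a, 'e::euclidean_space) manifold \<Rightarrow> 'a metric_tensor \<Rightarrow> 'a connection \<Rightarrow>
   'a vfield \<Rightarrow> 'a vfield \<Rightarrow> 'a vfield \<Rightarrow> 'a vfield \<Rightarrow> 'a \<Rightarrow> real" where
  "riemann M g nabla u v w z =
     ip g (nabla u (nabla v w) - nabla v (nabla u w) - nabla (bracket M u v) w) z"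

definition orthonormal_frame ::
  "('a, 'e::euclidean_space) manifold \<Rightarrow> 'a metric_tensor \<Rightarrow> 'a set \<Rightarrow> 'a vfield list \<Rightarrow> bool" where
  "orthonormal_frame M g W es \<longleftrightarrow>
     length es = DIM('e) \<and>
     (\<forall>e\<in>set es. vector_field M W e) \<and>
     (\<forall>i<length es. \<forall>j<length es. \<forall>p\<in>W.
        ip g (es ! i) (es ! j) p = (if i = j then 1 else 0))"

text \<open>The scalar curvature is the trace of \<open>Ric(v, w) = tr (u \<mapsto> R(u, v) w)\<close>, positive on round
  spheres with the sign convention of \<^const>\<open>riemann\<close>. The trace does not depend on the frame, and
  smooth local orthonormal frames exist near every point.\<close>

definition has_scalar_curvature ::
  "('a, 'e::euclidean_space) manifold \<Rightarrow> 'a metric_tensor \<Rightarrow> 'a connection \<Rightarrow> 'a \<Rightarrow> real \<Rightarrow> bool" where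
  "has_scalar_curvature M g nabla p s \<longleftrightarrow>
     (\<forall>W es. openin (mtop M) W \<longrightarrow> p \<in> W \<longrightarrow> orthonormal_frame M g W es \<longrightarrow>
        (\<Sum>i<DIM('e). \<Sum>j<DIM('e).
           riemann M g nabla (es ! i) (es ! j) (es ! j) (es ! i) p) = s)"


section \<open>Conditions on a vector field\<close>

definition unit_vector_field ::
  "('a, 'e::euclidean_space) manifold \<Rightarrow> 'a metric_tensor \<Rightarrow> 'a set \<Rightarrow> 'a vfield \<Rightarrow> bool" where
  "unit_vector_field M g U k \<longleftrightarrow> vector_field M U k \<and> (\<forall>p\<in>U. ip g k k p = 1)"

definition two_principal ::
  "('a, 'e::euclidean_space) manifold \<Rightarrow> 'a metric_tensor \<Rightarrow> 'a connection \<Rightarrow>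
   'a set \<Rightarrow> 'a vfield \<Rightarrow> bool" where
  "two_principal M g nabla U k \<longleftrightarrow>
     (\<forall>W v w z. openin (mtop M) W \<longrightarrow> W \<subseteq> U \<longrightarrow>
        vector_field M W v \<longrightarrow> vector_field M W w \<longrightarrow> vector_field M W z \<longrightarrow>
        (\<forall>p\<in>W. riemann M g nabla k v w z p = 0))"

text \<open>For 3-manifolds.\<close>

definition hypersurface_orthogonal ::
  "('a, 'e::euclidean_space) manifold \<Rightarrow> 'a metric_tensor \<Rightarrow> 'a connection \<Rightarrow>
   'a set \<Rightarrow> 'a vfield \<Rightarrow> bool" where
  "hypersurface_orthogonal M g nabla U k \<longleftrightarrow>
     (\<forall>W x y. openin (mtop M) W \<longrightarrow> W \<subseteq> U \<longrightarrow> orthonormal_frame M g W [k, x, y] \<longrightarrow>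
        (\<forall>p\<in>W. ip g (nabla y k) x p - ip g (nabla x k) y p = 0))"

text \<open>The Lie derivative of the metric along \<open>k\<close> vanishes.\<close>

definition killing ::
  "('a, 'e::euclidean_space) manifold \<Rightarrow> 'a metric_tensor \<Rightarrow> 'a set \<Rightarrow> 'a vfield \<Rightarrow> bool" where
  "killing M g U k \<longleftrightarrow>
     (\<forall>W x y. openin (mtop M) W \<longrightarrow> W \<subseteq> U \<longrightarrow> vector_field M W x \<longrightarrow> vector_field M W y \<longrightarrow>
        (\<forall>p\<in>W. dird k (ip g x y) p - ip g (bracket M k x) y p - ip g x (bracket M k y) p = 0))"

end

theory Submission
  imports Defs
begin

text \<open>Both conditions turn out to say that \<open>k\<close> is parallel, \<open>nabla u k = 0\<close> for all \<open>u\<close>. Write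
  \<open>D u = nabla u k\<close>. Since \<open>k\<close> has unit length, \<open>D\<close> takes values in the plane orthogonal to \<open>k\<close>, and
  hypersurface orthogonality makes \<open>D\<close> symmetric on that plane.

  Killing's equation says that \<open>D\<close> is skew. A symmetric and skew endomorphism of the plane vanishes, and
  skewness also gives \<open>D k = 0\<close>, so \<open>k\<close> is parallel (\<open>killing_imp_parallel\<close>). Then \<open>R(w, z) k = 0\<close>, and pair
  symmetry gives \<open>R(k, v, w, z) = 0\<close> (\<open>parallel_imp_principal\<close>).

  Conversely let \<open>R(k, -, -, -) = 0\<close> and complete \<open>k\<close> to an orthonormal frame \<open>k, x, y\<close>. The curvature
  then has the single component \<open>R(x, y, y, x)\<close>, which is half the scalar curvature, hence a nonzero
  constant. The second Bianchi identity on \<open>k, x, y\<close> therefore involves no derivative of curvature, only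
  covariant derivatives of the frame multiplied by this constant. It yields \<open>D k = 0\<close>
  (\<open>principal_geodesic\<close>) and \<open>tr D = 0\<close> (\<open>principal_divergence\<close>). Along the geodesic field \<open>k\<close> the
  equation \<open>R(k, u) k = 0\<close> is the Riccati equation \<open>nabla k D = - D\<^sup>2\<close> (\<open>principal_riccati\<close>). Its trace
  gives \<open>tr D\<^sup>2 = 0\<close>, and as \<open>D\<close> is symmetric, \<open>D = 0\<close> (\<open>principal_imp_parallel\<close>). So \<open>k\<close> is parallel and
  therefore Killing.

  Tangent vectors being derivations, the use of frames rests on the fact that the coordinate fields
  span the tangent spaces, which is Hadamard's lemma (\<open>tangent_expand\<close>). The curvature identities are
  derived for vector fields on an open set. That the curvature depends on its arguments pointwise is
  obvious for the last slot, and the symmetries extend it to the others.\<close>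

section \<open>Calculus of smooth functions on open sets\<close>

lemma Ck_on_subset: "Ck_on n f S \<Longrightarrow> T \<subseteq> S \<Longrightarrow> Ck_on n f T"
  by (induction n arbitrary: f) (auto intro: continuous_on_subset)

lemma Ck_on_cong:
  assumes "open S" "\<And>x. x \<in> S \<Longrightarrow> f x = g x" "Ck_on n f S"
  shows "Ck_on n g S"
  using assms(2,3)
proof (induction n arbitrary: f g)
  case 0
  then show ?case by (auto cong: continuous_on_cong)
next
  case (Suc n)
  have D: "(g has_derivative frechet_derivative f (at x)) (at x)" if "x \<in> S" for x
  proof (rule has_derivative_transform_within_open[OF _ assms(1) that Suc.prems(1)])
    show "(f has_derivative frechet_derivative f (at x)) (at x)"
      using Suc.prems(2) that by (simp add: frechet_derivative_works)
  qed
  have "Ck_on n (\<lambda>x. frechet_derivative g (at x) v) S" for v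
    by (rule Suc.IH[of "\<lambda>x. frechet_derivative f (at x) v"])
      (use Suc.prems(2) in \<open>simp_all add: frechet_derivative_at[OF D, symmetric]\<close>)
  then show ?case
    using D by (auto simp: differentiable_def)
qed

lemma Ck_on_SucI:
  assumes "open S" "\<And>x. x \<in> S \<Longrightarrow> (f has_derivative f' x) (at x)"
    and "\<And>v. Ck_on n (\<lambda>x. f' x v) S"
  shows "Ck_on (Suc n) f S"
proof -
  have "Ck_on n (\<lambda>x. frechet_derivative f (at x) v) S" for v
    by (rule Ck_on_cong[OF assms(1) _ assms(3)[of v]]) (simp add: frechet_derivative_at[OF assms(2), symmetric])
  then show ?thesis
    using assms(2) by (auto simp: differentiable_def)
qed

lemma Ck_on_Suc_has_derivative:
  assumes "Ck_on (Suc n) f S" "x \<in> S"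
  shows "(f has_derivative frechet_derivative f (at x)) (at x)"
  using assms by (simp add: frechet_derivative_works)

lemma Ck_on_SucD: "Ck_on (Suc n) f S \<Longrightarrow> Ck_on n f S"
proof (induction n arbitrary: f)
  case 0
  then show ?case
    by (auto intro!: continuous_at_imp_continuous_on differentiable_imp_continuous_within)
next
  case (Suc n)
  from Suc.prems have d: "\<forall>x\<in>S. f differentiable at x"
    and e: "\<And>v. Ck_on (Suc n) (\<lambda>x. frechet_derivative f (at x) v) S"
    by (subst (asm) Ck_on.simps; simp)+
  show ?case using d Suc.IH[OF e] by simp
qed

lemma Ck_on_const: "open S \<Longrightarrow> Ck_on n (\<lambda>x. c) S"
proof (induction n arbitrary: c)
  case (Suc n)
  show ?case by (rule Ck_on_SucI[OF Suc.prems has_derivative_const]) (use Suc in simp)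
qed simp

lemma Ck_on_bounded_linear:
  assumes "open S" "bounded_linear f"
  shows "Ck_on n f S"
proof (cases n)
  case (Suc m)
  show ?thesis unfolding Suc
    by (rule Ck_on_SucI[OF assms(1) bounded_linear_imp_has_derivative[OF assms(2)]])
      (rule Ck_on_const[OF assms(1)])
qed (simp add: assms linear_continuous_on)

lemma Ck_on_add:
  assumes "open S" "Ck_on n f S" "Ck_on n g S"
  shows "Ck_on n (\<lambda>x. f x + g x) S"
  using assms(2,3)
proof (induction n arbitrary: f g)
  case (Suc n)
  show ?case
    by (rule Ck_on_SucI[OF assms(1) has_derivative_add[OF Ck_on_Suc_has_derivative[OF Suc.prems(1)]
              Ck_on_Suc_has_derivative[OF Suc.prems(2)]]])
       (use Suc in auto)
qed (auto intro: continuous_intros)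

lemma Ck_on_sum:
  assumes "open S" "\<And>i. i \<in> I \<Longrightarrow> Ck_on n (f i) S"
  shows "Ck_on n (\<lambda>x. \<Sum>i\<in>I. f i x) S"
  using assms(2)
  by (induction I rule: infinite_finite_induct) (simp_all add: Ck_on_const Ck_on_add assms(1))

lemma (in bounded_bilinear) Ck_on_prod:
  fixes f :: "'e::euclidean_space \<Rightarrow> 'a"
  assumes "open S" "Ck_on n f S" "Ck_on n g S"
  shows "Ck_on n (\<lambda>x. prod (f x) (g x)) S"
  using assms(2,3)
proof (induction n arbitrary: f g)
  case 0
  then show ?case by (auto intro: continuous_on)
next
  case (Suc n)
  show ?case
  proof (rule Ck_on_SucI[OF assms(1) FDERIV[OF Ck_on_Suc_has_derivative[OF Suc.prems(1)]
              Ck_on_Suc_has_derivative[OF Suc.prems(2)]]])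
    fix v
    show "Ck_on n (\<lambda>x. prod (f x) (frechet_derivative g (at x) v) +
        prod (frechet_derivative f (at x) v) (g x)) S"
      using Suc.prems Ck_on_SucD[OF Suc.prems(1)] Ck_on_SucD[OF Suc.prems(2)]
      by (intro Ck_on_add assms(1) Suc.IH) auto
  qed auto
qed

lemma Ck_on_compose:
  fixes g :: "'e::euclidean_space \<Rightarrow> 'f::euclidean_space"
  assumes "open S" "open T" "g ` S \<subseteq> T" "Ck_on n f T" "Ck_on n g S"
  shows "Ck_on n (f \<circ> g) S"
  using assms(4,5)
proof (induction n arbitrary: f)
  case 0
  then have "continuous_on T f" "continuous_on S g" by simp_all
  then have "continuous_on S (f \<circ> g)"
    by (intro continuous_on_compose continuous_on_subset[OF _ assms(3)])
  then show ?case by simp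
next
  case (Suc n)
  \<comment> \<open>The chain rule, with the inner derivative expanded in the standard basis: this makes the
    derivative of the composition a sum of products to which the induction hypothesis applies.\<close>
  let ?D = "\<lambda>x v. \<Sum>b\<in>Basis. (frechet_derivative g (at x) v \<bullet> b) *\<^sub>R (frechet_derivative f (at (g x)) b)"
  have D: "(f \<circ> g has_derivative ?D x) (at x)" if "x \<in> S" for x
  proof (rule has_derivative_eq_rhs)
    have "g x \<in> T" using that assms(3) by blast
    then have f': "(f has_derivative frechet_derivative f (at (g x))) (at (g x))"
      by (rule Ck_on_Suc_has_derivative[OF Suc.prems(1)])
    show "(f \<circ> g has_derivative frechet_derivative f (at (g x)) \<circ> frechet_derivative g (at x)) (at x)"
      by (rule diff_chain_at[OF Ck_on_Suc_has_derivative[OF Suc.prems(2) that] f'])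
    have lin: "linear (frechet_derivative f (at (g x)))"
      using f' by (rule has_derivative_linear)
    have "frechet_derivative f (at (g x)) (\<Sum>b\<in>Basis. (w \<bullet> b) *\<^sub>R b) =
        (\<Sum>b\<in>Basis. (w \<bullet> b) *\<^sub>R frechet_derivative f (at (g x)) b)" for w
      by (simp only: linear_sum[OF lin] linear_scale[OF lin])
    then show "frechet_derivative f (at (g x)) \<circ> frechet_derivative g (at x) = ?D x"
      unfolding o_def euclidean_representation by (rule ext)
  qed
  show ?case
  proof (rule Ck_on_SucI[OF assms(1) D])
    fix v
    show "Ck_on n (\<lambda>x. ?D x v) S"
    proof (intro Ck_on_sum assms(1) bounded_bilinear.Ck_on_prod[OF bounded_bilinear_scaleR]
        bounded_bilinear.Ck_on_prod[OF bounded_bilinear_inner] Ck_on_const)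
      show "Ck_on n (\<lambda>x. frechet_derivative g (at x) v) S"
        using Suc.prems by simp
      show "Ck_on n (\<lambda>x. frechet_derivative f (at (g x)) b) S" for b
        using Suc.IH[of "\<lambda>y. frechet_derivative f (at y) b"] Suc.prems Ck_on_SucD[OF Suc.prems(2)]
        by (simp add: o_def)
    qed
  qed auto
qed

lemma Ck_on_powr: "Ck_on n (\<lambda>t::real. c * t powr a) {0<..}"
proof (induction n arbitrary: a c)
  case 0
  then show ?case by (auto intro!: continuous_intros)
next
  case (Suc n)
  show ?case
  proof (rule Ck_on_SucI)
    fix t :: real assume "t \<in> {0<..}"
    then show "((\<lambda>t. c * t powr a) has_derivative (\<lambda>v. (v * c * a) * t powr (a - 1))) (at t)"
      using has_derivative_mult_right[OF has_real_derivative_powr[of t a, unfolded has_field_derivative_def], of c]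
      by (simp add: algebra_simps)
  qed (use Suc in auto)
qed

text \<open>This supplies the smooth remainder in Hadamard's lemma. The induction differentiates under the
  integral; each differentiation produces a factor \<open>t\<close>, which is why the weights \<open>t ^ m\<close> are there.\<close>

lemma Ck_on_segment_average:
  fixes F :: "'e::euclidean_space \<Rightarrow> real"
  assumes "Ck_on n F (ball p r)"
  shows "Ck_on n (\<lambda>x. integral (cbox 0 1) (\<lambda>t. t ^ m * F (p + t *\<^sub>R (x - p)))) (ball p r)"
  using assms
proof (induction n arbitrary: F m)
  have seg: "p + t *\<^sub>R (x - p) \<in> ball p r" if "x \<in> ball p r" "t \<in> cbox 0 1" for x and t :: real
  proof -
    have "\<bar>t\<bar> * norm (x - p) \<le> 1 * norm (x - p)" using that by (intro mult_right_mono) auto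
    then show ?thesis using that by (simp add: dist_norm norm_minus_commute)
  qed
  have cont: "continuous_on (ball p r \<times> cbox 0 1) (\<lambda>(x, t). t ^ m * G (p + t *\<^sub>R (x - p)))"
    if "continuous_on (ball p r) G" for G :: "'e \<Rightarrow> real" and m
    using seg by (auto simp: split_beta intro!: continuous_intros continuous_on_compose2[OF that])
  {
    case 0
    then show ?case using integral_continuous_on_param[OF cont] by simp
  next
    case (Suc n)
    let ?D = "\<lambda>x. frechet_derivative F (at x)"
    let ?B = "\<lambda>x t. (t ^ Suc m) *\<^sub>R Blinfun (?D (p + t *\<^sub>R (x - p)))"
    have F': "(F has_derivative ?D x) (at x)" if "x \<in> ball p r" for x
      using Ck_on_Suc_has_derivative[OF Suc.prems that] .
    have B: "blinfun_apply (?B x t) v = t ^ Suc m * ?D (p + t *\<^sub>R (x - p)) v"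
      if "x \<in> ball p r" "t \<in> cbox 0 1" for x v and t :: real
      using has_derivative_bounded_linear[OF F'[OF seg[OF that]]]
      by (simp add: bounded_linear_Blinfun_apply scaleR_blinfun.rep_eq)
    have Dc: "continuous_on (ball p r) (\<lambda>x. ?D x v)" for v
    proof -
      have "Ck_on n (\<lambda>x. ?D x v) (ball p r)" using Suc.prems by simp
      then have "Ck_on 0 (\<lambda>x. ?D x v) (ball p r)" by (induction n) (auto dest: Ck_on_SucD simp del: Ck_on.simps)
      then show ?thesis by simp
    qed
    have Bc: "continuous_on (ball p r \<times> cbox 0 1) (\<lambda>(x, t). ?B x t)"
    proof (rule continuous_on_blinfun_componentwise)
      fix i :: 'e
      show "continuous_on (ball p r \<times> cbox 0 1) (\<lambda>z. blinfun_apply (case z of (x, t) \<Rightarrow> ?B x t) i)"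
        by (rule continuous_on_eq[OF cont[OF Dc, of "Suc m" i]]) (use B in auto)
    qed
    have "((\<lambda>x. integral (cbox 0 1) (\<lambda>t. t ^ m * F (p + t *\<^sub>R (x - p))))
        has_derivative blinfun_apply (integral (cbox 0 1) (?B x))) (at x within ball p r)"
      if x: "x \<in> ball p r" for x
    proof (rule leibniz_rule[OF _ _ Bc x convex_ball])
      fix x t assume x: "x \<in> ball p r" and t: "t \<in> cbox 0 (1::real)"
      have "((\<lambda>x. F (p + t *\<^sub>R (x - p))) has_derivative (\<lambda>v. ?D (p + t *\<^sub>R (x - p)) (t *\<^sub>R v))) (at x)"
        by (rule has_derivative_compose[of "\<lambda>x. p + t *\<^sub>R (x - p)" "\<lambda>v. t *\<^sub>R v", OF _ F'[OF seg[OF x t]]])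
          (auto intro!: derivative_eq_intros)
      then have "((\<lambda>x. t ^ m * F (p + t *\<^sub>R (x - p))) has_derivative
          (\<lambda>v. t ^ m * ?D (p + t *\<^sub>R (x - p)) (t *\<^sub>R v))) (at x)"
        by (rule has_derivative_mult_right)
      moreover have "(\<lambda>v. t ^ m * ?D (p + t *\<^sub>R (x - p)) (t *\<^sub>R v)) = blinfun_apply (?B x t)"
        using linear_scale[OF has_derivative_linear[OF F'[OF seg[OF x t]]], of t] B[OF x t]
        by (auto simp: fun_eq_iff)
      ultimately show "((\<lambda>x. t ^ m * F (p + t *\<^sub>R (x - p))) has_derivative blinfun_apply (?B x t))
          (at x within ball p r)"
        by (simp add: has_derivative_at_withinI)
    next
      fix x assume x: "x \<in> ball p r"
      have Fc: "continuous_on (ball p r) F"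
        using F' by (meson continuous_at_imp_continuous_on has_derivative_continuous)
      have "continuous_on (cbox 0 1) (\<lambda>t. F (p + t *\<^sub>R (x - p)))"
        by (rule continuous_on_compose2[OF Fc]) (use seg[OF x] in \<open>auto intro!: continuous_intros\<close>)
      then show "(\<lambda>t. t ^ m * F (p + t *\<^sub>R (x - p))) integrable_on cbox 0 1"
        by (intro integrable_continuous continuous_intros)
    qed
    moreover have "blinfun_apply (integral (cbox 0 1) (?B x)) v =
        integral (cbox 0 1) (\<lambda>t. t ^ Suc m * ?D (p + t *\<^sub>R (x - p)) v)" if x: "x \<in> ball p r" for x v
    proof -
      have "?B x integrable_on cbox 0 1"
      proof (rule integrable_continuous)
        have "continuous_on (cbox 0 1) (\<lambda>t. case (x, t) of (x, t) \<Rightarrow> ?B x t)"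
          by (rule continuous_on_compose2[OF Bc continuous_on_Pair[OF continuous_on_const continuous_on_id]])
            (use x in auto)
        then show "continuous_on (cbox 0 1) (?B x)" by simp
      qed
      then show ?thesis
        unfolding blinfun_apply_integral[OF \<open>?B x integrable_on cbox 0 1\<close>]
        by (intro integral_cong B[OF x])
    qed
    ultimately have D: "((\<lambda>x. integral (cbox 0 1) (\<lambda>t. t ^ m * F (p + t *\<^sub>R (x - p))))
        has_derivative (\<lambda>v. integral (cbox 0 1) (\<lambda>t. t ^ Suc m * ?D (p + t *\<^sub>R (x - p)) v))) (at x)"
      if "x \<in> ball p r" for x
      unfolding at_within_open[OF that open_ball, symmetric]
      by (rule has_derivative_eq_rhs[OF _ ext]) (fact that)+
    show ?case
    proof (rule Ck_on_SucI[OF open_ball D])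
      show "Ck_on n (\<lambda>x. integral (cbox 0 1) (\<lambda>t. t ^ Suc m * ?D (p + t *\<^sub>R (x - p)) v)) (ball p r)" for v
        by (rule Suc.IH[of "\<lambda>y. ?D y v" "Suc m"]) (use Suc.prems in simp)
    qed
  }
qed

lemma smooth_on_subset: "smooth_on f S \<Longrightarrow> T \<subseteq> S \<Longrightarrow> smooth_on f T"
  unfolding smooth_on_def by (blast intro: Ck_on_subset)

lemma smooth_on_cong: "open S \<Longrightarrow> (\<And>x. x \<in> S \<Longrightarrow> f x = g x) \<Longrightarrow> smooth_on f S \<Longrightarrow> smooth_on g S"
  unfolding smooth_on_def by (blast intro: Ck_on_cong)

lemma smooth_on_has_derivative:
  "smooth_on f S \<Longrightarrow> x \<in> S \<Longrightarrow> (f has_derivative frechet_derivative f (at x)) (at x)"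
  unfolding smooth_on_def by (blast intro: Ck_on_Suc_has_derivative)

lemma smooth_on_frechet_derivative:
  assumes "smooth_on f S" shows "smooth_on (\<lambda>x. frechet_derivative f (at x) v) S"
  unfolding smooth_on_def
proof
  fix n
  have "Ck_on (Suc n) f S" using assms unfolding smooth_on_def by blast
  then show "Ck_on n (\<lambda>x. frechet_derivative f (at x) v) S" by simp
qed

lemma smooth_on_const: "open S \<Longrightarrow> smooth_on (\<lambda>x. c) S"
  unfolding smooth_on_def by (blast intro: Ck_on_const)

lemma smooth_on_bounded_linear: "open S \<Longrightarrow> bounded_linear f \<Longrightarrow> smooth_on f S"
  unfolding smooth_on_def by (blast intro: Ck_on_bounded_linear)

lemma smooth_on_add:
  "open S \<Longrightarrow> smooth_on f S \<Longrightarrow> smooth_on g S \<Longrightarrow> smooth_on (\<lambda>x. f x + g x) S"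
  unfolding smooth_on_def by (blast intro: Ck_on_add)

lemma smooth_on_mult:
  fixes f g :: "'e::euclidean_space \<Rightarrow> real"
  shows "open S \<Longrightarrow> smooth_on f S \<Longrightarrow> smooth_on g S \<Longrightarrow> smooth_on (\<lambda>x. f x * g x) S"
  unfolding smooth_on_def
  by (blast intro: bounded_bilinear.Ck_on_prod[OF bounded_bilinear_mult])

lemma smooth_on_compose:
  fixes g :: "'e::euclidean_space \<Rightarrow> 'f::euclidean_space"
  shows "open S \<Longrightarrow> open T \<Longrightarrow> g ` S \<subseteq> T \<Longrightarrow> smooth_on f T \<Longrightarrow> smooth_on g S \<Longrightarrow> smooth_on (f \<circ> g) S"
  unfolding smooth_on_def by (blast intro: Ck_on_compose)

lemma smooth_on_powr:
  fixes f :: "'e::euclidean_space \<Rightarrow> real"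
  assumes "open S" "smooth_on f S" "\<And>x. x \<in> S \<Longrightarrow> f x > 0"
  shows "smooth_on (\<lambda>x. f x powr a) S"
proof -
  have "smooth_on (\<lambda>t::real. t powr a) {0<..}"
    unfolding smooth_on_def using Ck_on_powr[of _ 1 a] by simp
  then have "smooth_on ((\<lambda>t. t powr a) \<circ> f) S"
    using assms by (intro smooth_on_compose[of S "{0<..}"]) auto
  then show ?thesis by (simp add: o_def)
qed

text \<open>Hadamard's lemma: integrate the derivative of \<open>f\<close> along the segment from \<open>p\<close> to \<open>x\<close>. It is
  what makes every derivation at a point a combination of partial derivatives.\<close>

lemma hadamard:
  fixes f :: "'e::euclidean_space \<Rightarrow> real"
  assumes f: "smooth_on f (ball p r)"
  obtains h where "\<And>b. smooth_on (h b) (ball p r)"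
    and "\<And>x. x \<in> ball p r \<Longrightarrow> f x = f p + (\<Sum>b\<in>Basis. ((x - p) \<bullet> b) * h b x)"
    and "\<And>b. h b p = frechet_derivative f (at p) b"
proof
  let ?D = "\<lambda>x. frechet_derivative f (at x)"
  define h where "h b x = integral (cbox 0 1) (\<lambda>t. ?D (p + t *\<^sub>R (x - p)) b)" for b x
  show "smooth_on (h b) (ball p r)" for b
    using smooth_on_frechet_derivative[OF f, of b] Ck_on_segment_average[of _ "\<lambda>x. ?D x b" p r 0]
    unfolding smooth_on_def h_def by simp
  show "h b p = frechet_derivative f (at p) b" for b
    by (simp add: h_def)
  fix x assume x: "x \<in> ball p r"
  have seg: "p + t *\<^sub>R (x - p) \<in> ball p r" if "t \<in> {0..1}" for t :: real
  proof -
    have "\<bar>t\<bar> * norm (x - p) \<le> 1 * norm (x - p)" using that by (intro mult_right_mono) auto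
    then show ?thesis using x by (simp add: dist_norm norm_minus_commute)
  qed
  have cont: "continuous_on {0..1} (\<lambda>t. ?D (p + t *\<^sub>R (x - p)) b)" for b
  proof -
    have "Ck_on 0 (\<lambda>x. ?D x b) (ball p r)"
      using smooth_on_frechet_derivative[OF f, of b] unfolding smooth_on_def by blast
    then show ?thesis
      using seg by (auto intro!: continuous_on_compose2[of "ball p r" "\<lambda>x. ?D x b"] continuous_intros)
  qed
  have "((\<lambda>t. ?D (p + t *\<^sub>R (x - p)) (x - p)) has_integral f (p + 1 *\<^sub>R (x - p)) - f (p + 0 *\<^sub>R (x - p))) {0..1}"
  proof (rule fundamental_theorem_of_calculus)
    fix t :: real assume t: "t \<in> {0..1}"
    have "((\<lambda>t. f (p + t *\<^sub>R (x - p))) has_derivative (\<lambda>s. ?D (p + t *\<^sub>R (x - p)) (s *\<^sub>R (x - p)))) (at t)"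
      by (rule has_derivative_compose[of "\<lambda>t. p + t *\<^sub>R (x - p)" "\<lambda>s. s *\<^sub>R (x - p)",
            OF _ smooth_on_has_derivative[OF f seg[OF t]]])
        (auto intro!: derivative_eq_intros)
    then show "((\<lambda>t. f (p + t *\<^sub>R (x - p))) has_vector_derivative ?D (p + t *\<^sub>R (x - p)) (x - p)) (at t within {0..1})"
      using linear_scale[OF has_derivative_linear[OF smooth_on_has_derivative[OF f seg[OF t]]]]
      by (simp add: has_vector_derivative_def has_derivative_at_withinI)
  qed simp
  then have "f x - f p = integral {0..1} (\<lambda>t. ?D (p + t *\<^sub>R (x - p)) (x - p))"
    by (simp add: integral_unique)
  also have "\<dots> = integral {0..1} (\<lambda>t. \<Sum>b\<in>Basis. ((x - p) \<bullet> b) * ?D (p + t *\<^sub>R (x - p)) b)"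
  proof (rule integral_cong)
    fix t :: real assume t: "t \<in> {0..1}"
    have lin: "linear (?D (p + t *\<^sub>R (x - p)))"
      by (rule has_derivative_linear[OF smooth_on_has_derivative[OF f seg[OF t]]])
    have "?D (p + t *\<^sub>R (x - p)) (\<Sum>b\<in>Basis. ((x - p) \<bullet> b) *\<^sub>R b) =
        (\<Sum>b\<in>Basis. ((x - p) \<bullet> b) * ?D (p + t *\<^sub>R (x - p)) b)"
      by (simp only: linear_sum[OF lin] linear_scale[OF lin] real_scaleR_def)
    then show "?D (p + t *\<^sub>R (x - p)) (x - p) = (\<Sum>b\<in>Basis. ((x - p) \<bullet> b) * ?D (p + t *\<^sub>R (x - p)) b)"
      unfolding euclidean_representation .
  qed
  also have "\<dots> = (\<Sum>b\<in>Basis. integral {0..1} (\<lambda>t. ((x - p) \<bullet> b) * ?D (p + t *\<^sub>R (x - p)) b))"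
    by (intro integral_sum integrable_continuous_real continuous_intros cont) auto
  also have "\<dots> = (\<Sum>b\<in>Basis. ((x - p) \<bullet> b) * h b x)"
    by (simp add: h_def)
  finally show "f x = f p + (\<Sum>b\<in>Basis. ((x - p) \<bullet> b) * h b x)"
    by (simp add: algebra_simps)
qed

section \<open>Smooth functions and tangent vectors on a manifold\<close>

locale smooth_mfd =
  fixes M :: "('a, 'e::euclidean_space) manifold"
  assumes smooth_M: "smooth_manifold M"
begin

lemma
  assumes "(D, \<phi>) \<in> atlas M"
  shows chart_openin: "openin (mtop M) D"
    and chart_hom: "homeomorphic_map (subtopology (mtop M) D) (top_of_set (\<phi> ` D)) \<phi>"
    and chart_open: "open (\<phi> ` D)"
    and chart_inj: "inj_on \<phi> D"
proof -
  have c: "is_chart (mtop M) (D, \<phi>)"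
    using smooth_M assms unfolding smooth_manifold_def by blast
  then show D: "openin (mtop M) D"
    and h: "homeomorphic_map (subtopology (mtop M) D) (top_of_set (\<phi> ` D)) \<phi>"
    and "open (\<phi> ` D)"
    by (auto simp: is_chart_def)
  have "topspace (subtopology (mtop M) D) = D"
    using openin_subset[OF D] by auto
  then show "inj_on \<phi> D"
    using h by (simp add: homeomorphic_map_def)
qed

lemma chart_at:
  assumes "p \<in> topspace (mtop M)"
  obtains D \<phi> where "(D, \<phi>) \<in> atlas M" "p \<in> D"
  using assms smooth_M unfolding smooth_manifold_def by blast

lemma chart_inv [simp]: "(D, \<phi>) \<in> atlas M \<Longrightarrow> q \<in> D \<Longrightarrow> inv_into D \<phi> (\<phi> q) = q"
  using chart_inj by simp

lemma chart_open_image: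
  assumes "(D, \<phi>) \<in> atlas M" "openin (mtop M) V"
  shows "open (\<phi> ` (D \<inter> V))"
proof -
  have "openin (subtopology (mtop M) D) (D \<inter> V)"
    using assms(2) by (rule openin_subtopology_Int2)
  moreover have "D \<inter> V \<subseteq> topspace (subtopology (mtop M) D)"
    using openin_subset[OF assms(2)] by auto
  ultimately have "openin (top_of_set (\<phi> ` D)) (\<phi> ` (D \<inter> V))"
    using homeomorphic_map_openness[OF chart_hom[OF assms(1)]] by blast
  then show ?thesis
    using openin_open_eq[OF chart_open[OF assms(1)]] by blast
qed

lemma chart_open_preimage:
  assumes "(D, \<phi>) \<in> atlas M" "open B"
  shows "openin (mtop M) {q \<in> D. \<phi> q \<in> B}"
proof -
  have "continuous_map (subtopology (mtop M) D) (top_of_set (\<phi> ` D)) \<phi>"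
    using chart_hom[OF assms(1)] homeomorphic_imp_continuous_map by blast
  moreover have "openin (top_of_set (\<phi> ` D)) (\<phi> ` D \<inter> B)"
    using assms(2) by (rule openin_open_Int)
  ultimately have "openin (subtopology (mtop M) D)
      {q \<in> topspace (subtopology (mtop M) D). \<phi> q \<in> \<phi> ` D \<inter> B}"
    by (rule openin_continuous_map_preimage)
  moreover have "{q \<in> topspace (subtopology (mtop M) D). \<phi> q \<in> \<phi> ` D \<inter> B} = {q \<in> D. \<phi> q \<in> B}"
    using openin_subset[OF chart_openin[OF assms(1)]] by auto
  ultimately show ?thesis
    using openin_trans_full[OF _ chart_openin[OF assms(1)]] by simp
qed

lemma smooth_funI:
  assumes "\<And>D \<phi>. (D, \<phi>) \<in> atlas M \<Longrightarrow> smooth_on (f \<circ> inv_into D \<phi>) (\<phi> ` (D \<inter> W))"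
  shows "smooth_fun M W f"
  using assms unfolding smooth_fun_def by blast

lemma smooth_funD:
  "smooth_fun M W f \<Longrightarrow> (D, \<phi>) \<in> atlas M \<Longrightarrow> smooth_on (f \<circ> inv_into D \<phi>) (\<phi> ` (D \<inter> W))"
  unfolding smooth_fun_def by blast

lemma smooth_fun_subset: "smooth_fun M W f \<Longrightarrow> V \<subseteq> W \<Longrightarrow> smooth_fun M V f"
  by (rule smooth_funI, drule (1) smooth_funD, erule smooth_on_subset) auto

lemma smooth_fun_cong:
  assumes "openin (mtop M) W" "\<And>q. q \<in> W \<Longrightarrow> f q = h q" "smooth_fun M W f"
  shows "smooth_fun M W h"
proof (rule smooth_funI)
  fix D \<phi> assume c: "(D, \<phi>) \<in> atlas M"
  show "smooth_on (h \<circ> inv_into D \<phi>) (\<phi> ` (D \<inter> W))"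
    by (rule smooth_on_cong[OF chart_open_image[OF c assms(1)] _ smooth_funD[OF assms(3) c]])
      (use c assms(2) in auto)
qed

lemma smooth_fun_const: "openin (mtop M) W \<Longrightarrow> smooth_fun M W (\<lambda>q. c)"
  using smooth_on_const[OF chart_open_image] by (auto intro!: smooth_funI simp: o_def)

lemma smooth_fun_add:
  "openin (mtop M) W \<Longrightarrow> smooth_fun M W f \<Longrightarrow> smooth_fun M W h \<Longrightarrow> smooth_fun M W (\<lambda>q. f q + h q)"
  using smooth_on_add[OF chart_open_image smooth_funD smooth_funD]
  by (auto intro!: smooth_funI simp: o_def)

lemma smooth_fun_mult:
  "openin (mtop M) W \<Longrightarrow> smooth_fun M W f \<Longrightarrow> smooth_fun M W h \<Longrightarrow> smooth_fun M W (\<lambda>q. f q * h q)"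
  using smooth_on_mult[OF chart_open_image smooth_funD smooth_funD]
  by (auto intro!: smooth_funI simp: o_def)

lemma smooth_fun_powr:
  assumes W: "openin (mtop M) W" and f: "smooth_fun M W f" and pos: "\<And>q. q \<in> W \<Longrightarrow> f q > 0"
  shows "smooth_fun M W (\<lambda>q. f q powr a)"
proof (rule smooth_funI)
  fix D \<phi> assume c: "(D, \<phi>) \<in> atlas M"
  show "smooth_on ((\<lambda>q. f q powr a) \<circ> inv_into D \<phi>) (\<phi> ` (D \<inter> W))"
    using smooth_on_powr[OF chart_open_image[OF c W] smooth_funD[OF f c, unfolded o_def], of a]
      chart_inv[OF c] pos by (fastforce simp: o_def)
qed

text \<open>Transition maps are smooth, so one chart suffices to test smoothness.\<close>

lemma smooth_fun_chart:
  assumes c: "(D, \<phi>) \<in> atlas M" and V: "openin (mtop M) V" "V \<subseteq> D"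
    and f: "smooth_on (f \<circ> inv_into D \<phi>) (\<phi> ` V)"
  shows "smooth_fun M V f"
proof (rule smooth_funI)
  fix D' \<phi>' assume c': "(D', \<phi>') \<in> atlas M"
  let ?S = "\<phi>' ` (D' \<inter> V)"
  have S: "open ?S" using chart_open_image[OF c' V(1)] .
  have tr: "\<forall>(D, \<phi>)\<in>atlas M. \<forall>(D', \<phi>')\<in>atlas M. smooth_on (\<phi>' \<circ> inv_into D \<phi>) (\<phi> ` (D \<inter> D'))"
    using smooth_M unfolding smooth_manifold_def by (elim conjE)
  have "smooth_on (\<phi> \<circ> inv_into D' \<phi>') (\<phi>' ` (D' \<inter> D))"
    using bspec[OF bspec[OF tr c', simplified] c, simplified] .
  then have t: "smooth_on (\<phi> \<circ> inv_into D' \<phi>') ?S"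
    by (rule smooth_on_subset) (use V in auto)
  have "open (\<phi> ` V)"
    using chart_open_image[OF c V(1)] V(2) by (simp add: Int_absorb1)
  then have "smooth_on ((f \<circ> inv_into D \<phi>) \<circ> (\<phi> \<circ> inv_into D' \<phi>')) ?S"
    by (rule smooth_on_compose[OF S _ _ f t]) (use c' in auto)
  then show "smooth_on (f \<circ> inv_into D' \<phi>') ?S"
    by (rule smooth_on_cong[OF S, rotated]) (use c c' V in auto)
qed

lemma smooth_fun_coordinates:
  assumes c: "(D, \<phi>) \<in> atlas M" and V: "openin (mtop M) V" "V \<subseteq> D"
    and F: "smooth_on F (\<phi> ` V)"
  shows "smooth_fun M V (\<lambda>q. F (\<phi> q))"
proof (rule smooth_fun_chart[OF c V])
  have "open (\<phi> ` V)"
    using chart_open_image[OF c V(1)] V(2) by (simp add: Int_absorb1)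
  then show "smooth_on ((\<lambda>q. F (\<phi> q)) \<circ> inv_into D \<phi>) (\<phi> ` V)"
    by (rule smooth_on_cong[OF _ _ F]) (use c V in auto)
qed

lemma smooth_fun_coordinate:
  assumes c: "(D, \<phi>) \<in> atlas M" shows "smooth_fun M D (\<lambda>q. \<phi> q \<bullet> b)"
  using smooth_fun_coordinates[OF c chart_openin[OF c] order_refl, of "\<lambda>y. y \<bullet> b"]
    smooth_on_bounded_linear[OF chart_open[OF c] bounded_linear_inner_left] by simp

lemma smooth_nearI: "openin (mtop M) W \<Longrightarrow> p \<in> W \<Longrightarrow> smooth_fun M W f \<Longrightarrow> smooth_near M p f"
  unfolding smooth_near_def by blast

lemma smooth_near_cong:
  assumes "openin (mtop M) V" "p \<in> V" "\<And>q. q \<in> V \<Longrightarrow> f q = h q" "smooth_near M p f"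
  shows "smooth_near M p h"
proof -
  obtain W where W: "openin (mtop M) W" "p \<in> W" "smooth_fun M W f"
    using assms(4) unfolding smooth_near_def by blast
  have VW: "openin (mtop M) (V \<inter> W)" using assms(1) W(1) by (rule openin_Int)
  have "smooth_fun M (V \<inter> W) h"
    by (rule smooth_fun_cong[OF VW _ smooth_fun_subset[OF W(3)]]) (use assms in auto)
  then show ?thesis using smooth_nearI[OF VW] assms W by blast
qed

lemma
  assumes "smooth_near M p f" "smooth_near M p h"
  shows smooth_near_add: "smooth_near M p (\<lambda>q. f q + h q)"
    and smooth_near_mult: "smooth_near M p (\<lambda>q. f q * h q)"
proof -
  obtain V W where V: "openin (mtop M) V" "p \<in> V" "smooth_fun M V f"
    and W: "openin (mtop M) W" "p \<in> W" "smooth_fun M W h"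
    using assms unfolding smooth_near_def by blast
  have VW: "openin (mtop M) (V \<inter> W)" "p \<in> V \<inter> W" using V W by auto
  have s: "smooth_fun M (V \<inter> W) f" "smooth_fun M (V \<inter> W) h"
    using V W smooth_fun_subset by blast+
  show "smooth_near M p (\<lambda>q. f q + h q)" "smooth_near M p (\<lambda>q. f q * h q)"
    by (rule smooth_nearI[OF VW smooth_fun_add[OF VW(1) s]] smooth_nearI[OF VW smooth_fun_mult[OF VW(1) s]])+
qed

lemma smooth_near_const: "p \<in> topspace (mtop M) \<Longrightarrow> smooth_near M p (\<lambda>q. c)"
  by (rule smooth_nearI[OF openin_topspace _ smooth_fun_const[OF openin_topspace]])

lemma smooth_near_topspace: "smooth_near M p f \<Longrightarrow> p \<in> topspace (mtop M)"
  unfolding smooth_near_def using openin_subset by blast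

lemma tangent_add:
  "v \<in> tangent_space M p \<Longrightarrow> smooth_near M p f \<Longrightarrow> smooth_near M p h \<Longrightarrow>
    v (\<lambda>q. f q + h q) = v f + v h"
  unfolding tangent_space_def plus_fun_def by blast

lemma tangent_mult:
  "v \<in> tangent_space M p \<Longrightarrow> smooth_near M p f \<Longrightarrow> smooth_near M p h \<Longrightarrow>
    v (\<lambda>q. f q * h q) = v f * h p + f p * v h"
  unfolding tangent_space_def times_fun_def by blast

lemma tangent_scale:
  "v \<in> tangent_space M p \<Longrightarrow> smooth_near M p f \<Longrightarrow> v (\<lambda>q. a * f q) = a * v f"
  unfolding tangent_space_def by blast

lemma tangent_not_smooth: "v \<in> tangent_space M p \<Longrightarrow> \<not> smooth_near M p f \<Longrightarrow> v f = 0"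
  unfolding tangent_space_def by blast

lemma tangent_const:
  assumes "v \<in> tangent_space M p" "p \<in> topspace (mtop M)"
  shows "v (\<lambda>q. c) = 0"
proof -
  have "v (\<lambda>q. 1 * 1) = v (\<lambda>q. 1) * 1 + 1 * v (\<lambda>q. 1)"
    by (rule tangent_mult) (use assms smooth_near_const in auto)
  then have "v (\<lambda>q. 1) = 0" by simp
  then show ?thesis
    using tangent_scale[OF assms(1) smooth_near_const[OF assms(2), of 1], of c] by simp
qed

lemma tangent_minus:
  assumes "v \<in> tangent_space M p" "smooth_near M p f"
  shows "v (\<lambda>q. - f q) = - v f"
  using tangent_scale[OF assms, of "-1"] by simp

lemma smooth_near_minus: "smooth_near M p f \<Longrightarrow> smooth_near M p (\<lambda>q. - f q)"
  using smooth_near_mult[OF smooth_near_const[OF smooth_near_topspace], of p f f "-1"] by simp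

lemma tangent_diff:
  assumes "v \<in> tangent_space M p" "smooth_near M p f" "smooth_near M p h"
  shows "v (\<lambda>q. f q - h q) = v f - v h"
  using tangent_add[OF assms(1,2) smooth_near_minus[OF assms(3)]] tangent_minus[OF assms(1,3)] by simp

text \<open>Derivations are local, although the functions they act on are total: a difference that vanishes
  near \<open>p\<close> equals its product with a function that is smooth near \<open>p\<close> and vanishes there.\<close>

lemma tangent_cong:
  assumes v: "v \<in> tangent_space M p"
    and V: "openin (mtop M) V" "p \<in> V" "\<And>q. q \<in> V \<Longrightarrow> f q = h q"
  shows "v f = v h"
proof (cases "smooth_near M p f")
  case True
  then have h: "smooth_near M p h" using V by (rule smooth_near_cong[rotated -1])
  have p: "p \<in> topspace (mtop M)" using True by (rule smooth_near_topspace)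
  define bump :: "'a \<Rightarrow> real" where "bump q = (if q \<in> V then 0 else 1)" for q
  have s: "smooth_near M p bump" "smooth_near M p (\<lambda>q. f q - h q)"
    by (rule smooth_near_cong[OF V(1,2) _ smooth_near_const[OF p, of 0]], use V in \<open>simp add: bump_def\<close>)+
  have "(\<lambda>q. f q - h q) = (\<lambda>q. bump q * (f q - h q))"
    using V by (auto simp: bump_def)
  then have "v (\<lambda>q. f q - h q) = v bump * (f p - h p) + bump p * v (\<lambda>q. f q - h q)"
    using tangent_mult[OF v s] by simp
  then have "v (\<lambda>q. f q - h q) = 0"
    using V by (simp add: bump_def)
  then show ?thesis using tangent_diff[OF v True h] by simp
next
  case False
  then have "\<not> smooth_near M p h" using smooth_near_cong[OF V(1,2)] V(3) by metis
  then show ?thesis using False tangent_not_smooth[OF v] by simp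
qed

lemma tangent_space_add: "u \<in> tangent_space M p \<Longrightarrow> v \<in> tangent_space M p \<Longrightarrow> u + v \<in> tangent_space M p"
  unfolding tangent_space_def by (auto simp: algebra_simps)

lemma tangent_space_scale: "u \<in> tangent_space M p \<Longrightarrow> (\<lambda>f. a * u f) \<in> tangent_space M p"
  unfolding tangent_space_def by (auto simp: algebra_simps)

lemma tangent_space_0: "0 \<in> tangent_space M p"
  unfolding tangent_space_def by auto

lemma vector_field_tangent: "vector_field M W u \<Longrightarrow> p \<in> W \<Longrightarrow> u p \<in> tangent_space M p"
  unfolding vector_field_def by blast

lemma vector_field_dird:
  "vector_field M W u \<Longrightarrow> openin (mtop M) V \<Longrightarrow> V \<subseteq> W \<Longrightarrow> smooth_fun M V f \<Longrightarrow> smooth_fun M V (dird u f)"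
  unfolding vector_field_def by blast

lemma vector_field_subset: "vector_field M W u \<Longrightarrow> V \<subseteq> W \<Longrightarrow> vector_field M V u"
  unfolding vector_field_def by blast

lemma vector_field_cong:
  assumes "vector_field M W u" "\<And>q. q \<in> W \<Longrightarrow> u q = v q"
  shows "vector_field M W v"
  unfolding vector_field_def
proof (intro conjI allI impI ballI)
  show "v p \<in> tangent_space M p" if "p \<in> W" for p
    using assms that vector_field_tangent by fastforce
  fix V f assume V: "openin (mtop M) V" "V \<subseteq> W" "smooth_fun M V f"
  show "smooth_fun M V (dird v f)"
    by (rule smooth_fun_cong[OF V(1) _ vector_field_dird[OF assms(1) V]])
      (use assms V in \<open>auto simp: dird_def\<close>)
qed

lemma vector_field_add:
  assumes "vector_field M W u" "vector_field M W v"
  shows "vector_field M W (u + v)"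
  unfolding vector_field_def
proof (intro conjI allI impI ballI)
  show "(u + v) p \<in> tangent_space M p" if "p \<in> W" for p
    using assms that vector_field_tangent tangent_space_add by fastforce
  fix V f assume V: "openin (mtop M) V" "V \<subseteq> W" "smooth_fun M V f"
  show "smooth_fun M V (dird (u + v) f)"
    using smooth_fun_add[OF V(1) vector_field_dird[OF assms(1) V] vector_field_dird[OF assms(2) V]]
    by (simp add: dird_def)
qed

lemma vector_field_vscale:
  assumes "vector_field M W u" "smooth_fun M W a"
  shows "vector_field M W (vscale a u)"
  unfolding vector_field_def
proof (intro conjI allI impI ballI)
  show "vscale a u p \<in> tangent_space M p" if "p \<in> W" for p
    using tangent_space_scale[OF vector_field_tangent[OF assms(1) that]] by (simp add: vscale_def)
  fix V f assume V: "openin (mtop M) V" "V \<subseteq> W" "smooth_fun M V f"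
  show "smooth_fun M V (dird (vscale a u) f)"
    using smooth_fun_mult[OF V(1) smooth_fun_subset[OF assms(2) V(2)] vector_field_dird[OF assms(1) V]]
    by (simp add: dird_def vscale_def)
qed

lemma vector_field_0: "vector_field M W 0"
  unfolding vector_field_def using smooth_fun_const[of _ 0] by (auto simp: tangent_space_0 dird_def)

lemma vector_field_minus:
  assumes "openin (mtop M) W" "vector_field M W u" shows "vector_field M W (- u)"
  by (rule vector_field_cong[OF vector_field_vscale[OF assms(2) smooth_fun_const[OF assms(1), of "-1"]]])
    (simp add: vscale_def fun_Compl_def)

lemma vector_field_diff:
  assumes "openin (mtop M) W" "vector_field M W u" "vector_field M W v"
  shows "vector_field M W (u - v)"
  using vector_field_add[OF assms(2) vector_field_minus[OF assms(1,3)]] by simp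

lemma dird_smooth_near:
  "openin (mtop M) W \<Longrightarrow> vector_field M W u \<Longrightarrow> p \<in> W \<Longrightarrow> smooth_near M p f \<Longrightarrow>
    smooth_near M p (dird u f)"
proof -
  assume a: "openin (mtop M) W" "vector_field M W u" "p \<in> W" "smooth_near M p f"
  then obtain V where V: "openin (mtop M) V" "p \<in> V" "smooth_fun M V f"
    unfolding smooth_near_def by blast
  have VW: "openin (mtop M) (V \<inter> W)" using V(1) a(1) by (rule openin_Int)
  have "smooth_fun M (V \<inter> W) (dird u f)"
    using vector_field_dird[OF a(2) VW _ smooth_fun_subset[OF V(3)]] by blast
  then show ?thesis using smooth_nearI[OF VW] a V by blast
qed

section \<open>Coordinate fields span the tangent spaces\<close>

definition coordinate_field :: "'a set \<Rightarrow> ('a \<Rightarrow> 'e) \<Rightarrow> 'e \<Rightarrow> 'a vfield" where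
  "coordinate_field D \<phi> b = (\<lambda>p f. if smooth_near M p f
     then frechet_derivative (f \<circ> inv_into D \<phi>) (at (\<phi> p)) b else 0)"

lemma smooth_near_has_derivative:
  assumes "(D, \<phi>) \<in> atlas M" "p \<in> D" "smooth_near M p f"
  shows "(f \<circ> inv_into D \<phi> has_derivative frechet_derivative (f \<circ> inv_into D \<phi>) (at (\<phi> p))) (at (\<phi> p))"
proof -
  obtain W where W: "openin (mtop M) W" "p \<in> W" "smooth_fun M W f"
    using assms(3) unfolding smooth_near_def by blast
  show ?thesis
    by (rule smooth_on_has_derivative[OF smooth_funD[OF W(3) assms(1)]]) (use assms W in auto)
qed

lemma coordinate_field_eqI:
  assumes "smooth_near M p f" "(f \<circ> inv_into D \<phi> has_derivative f') (at (\<phi> p))"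
  shows "coordinate_field D \<phi> b p f = f' b"
  using assms frechet_derivative_at[OF assms(2)] by (simp add: coordinate_field_def)

lemma coordinate_field_vector_field:
  assumes c: "(D, \<phi>) \<in> atlas M"
  shows "vector_field M D (coordinate_field D \<phi> b)"
  unfolding vector_field_def
proof (intro conjI allI impI ballI)
  let ?X = "coordinate_field D \<phi> b"
  fix p assume p: "p \<in> D"
  let ?d = "\<lambda>f. frechet_derivative (f \<circ> inv_into D \<phi>) (at (\<phi> p))"
  have pt: "p \<in> topspace (mtop M)" using p openin_subset[OF chart_openin[OF c]] by blast
  {
    fix f h assume s: "smooth_near M p f" "smooth_near M p h"
    note d = smooth_near_has_derivative[OF c p s(1)] smooth_near_has_derivative[OF c p s(2)]
    have "((f + h) \<circ> inv_into D \<phi> has_derivative (\<lambda>w. ?d f w + ?d h w)) (at (\<phi> p))"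
      using has_derivative_add[OF d] by (simp add: o_def plus_fun_def)
    then have "?X p (f + h) = ?X p f + ?X p h"
      using coordinate_field_eqI[of p "f + h" D \<phi>] smooth_near_add[OF s] s
      by (simp add: plus_fun_def coordinate_field_def)
    moreover have "((f * h) \<circ> inv_into D \<phi> has_derivative (\<lambda>w. f p * ?d h w + ?d f w * h p)) (at (\<phi> p))"
      using has_derivative_mult[OF d] c p by (simp add: o_def times_fun_def)
    then have "?X p (f * h) = ?X p f * h p + f p * ?X p h"
      using coordinate_field_eqI[of p "f * h" D \<phi>] smooth_near_mult[OF s] s
      by (simp add: times_fun_def coordinate_field_def)
    ultimately have "?X p (f + h) = ?X p f + ?X p h \<and> ?X p (f * h) = ?X p f * h p + f p * ?X p h" ..
  }
  moreover have "?X p (\<lambda>q. a * f q) = a * ?X p f" if s: "smooth_near M p f" for a f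
  proof -
    have "((\<lambda>q. a * f q) \<circ> inv_into D \<phi> has_derivative (\<lambda>w. a * ?d f w)) (at (\<phi> p))"
      using has_derivative_mult_right[OF smooth_near_has_derivative[OF c p s], of a] by (simp add: o_def)
    then show ?thesis
      using coordinate_field_eqI[of p "\<lambda>q. a * f q" D \<phi>]
        smooth_near_mult[OF smooth_near_const[OF pt, of a] s] s
      by (simp add: coordinate_field_def)
  qed
  moreover have "?X p f = 0" if "\<not> smooth_near M p f" for f
    using that by (simp add: coordinate_field_def)
  ultimately show "?X p \<in> tangent_space M p"
    unfolding tangent_space_def by blast
next
  fix V f assume V: "openin (mtop M) V" "V \<subseteq> D" and f: "smooth_fun M V f"
  have "smooth_on (\<lambda>y. frechet_derivative (f \<circ> inv_into D \<phi>) (at y) b) (\<phi> ` (D \<inter> V))"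
    by (rule smooth_on_frechet_derivative[OF smooth_funD[OF f c]])
  then have "smooth_fun M V (\<lambda>q. frechet_derivative (f \<circ> inv_into D \<phi>) (at (\<phi> q)) b)"
    using smooth_fun_coordinates[OF c V] V(2) by (simp add: Int_absorb1)
  then show "smooth_fun M V (dird (coordinate_field D \<phi> b) f)"
    by (rule smooth_fun_cong[OF V(1), rotated])
      (simp add: dird_def coordinate_field_def smooth_nearI[OF V(1) _ f])
qed

lemma coordinate_field_coordinate:
  assumes c: "(D, \<phi>) \<in> atlas M" and p: "p \<in> D"
  shows "coordinate_field D \<phi> b p (\<lambda>q. \<phi> q \<bullet> b') = b \<bullet> b'"
proof (rule coordinate_field_eqI)
  show "smooth_near M p (\<lambda>q. \<phi> q \<bullet> b')"
    using smooth_nearI[OF chart_openin[OF c] p smooth_fun_coordinate[OF c]] .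
  have "((\<lambda>y. y \<bullet> b') has_derivative (\<lambda>v. v \<bullet> b')) (at (\<phi> p))"
    by (rule bounded_linear_imp_has_derivative[OF bounded_linear_inner_left])
  then show "((\<lambda>q. \<phi> q \<bullet> b') \<circ> inv_into D \<phi> has_derivative (\<lambda>v. v \<bullet> b')) (at (\<phi> p))"
    by (rule has_derivative_transform_within_open[OF _ chart_open[OF c]])
      (use c p in auto)
qed

lemma tangent_sum:
  assumes v: "v \<in> tangent_space M p" and p: "p \<in> topspace (mtop M)"
    and F: "\<And>i. i \<in> I \<Longrightarrow> smooth_near M p (F i)"
  shows "smooth_near M p (\<lambda>q. \<Sum>i\<in>I. F i q) \<and> v (\<lambda>q. \<Sum>i\<in>I. F i q) = (\<Sum>i\<in>I. v (F i))"
  using F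
proof (induction I rule: infinite_finite_induct)
  case (insert i I)
  then show ?case
    using smooth_near_add[of p "F i" "\<lambda>q. \<Sum>i\<in>I. F i q"]
      tangent_add[OF v, of "F i" "\<lambda>q. \<Sum>i\<in>I. F i q"] by simp
qed (use smooth_near_const[OF p] tangent_const[OF v p] in simp_all)

text \<open>By Hadamard's lemma, a derivation sees of a function only its value and its first partial
  derivatives.\<close>

lemma tangent_expand:
  assumes c: "(D, \<phi>) \<in> atlas M" and p: "p \<in> D" and v: "v \<in> tangent_space M p"
  shows "v f = (\<Sum>b\<in>Basis. v (\<lambda>q. \<phi> q \<bullet> b) * coordinate_field D \<phi> b p f)"
proof (cases "smooth_near M p f")
  case False
  then show ?thesis using tangent_not_smooth[OF v] by (simp add: coordinate_field_def)
next
  case True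
  then obtain W where W: "openin (mtop M) W" "p \<in> W" "smooth_fun M W f"
    unfolding smooth_near_def by blast
  have pt: "p \<in> topspace (mtop M)" using True by (rule smooth_near_topspace)
  obtain r where r: "r > 0" "ball (\<phi> p) r \<subseteq> \<phi> ` (D \<inter> W)"
    using chart_open_image[OF c W(1)] p W(2) open_contains_ball by blast
  let ?F = "f \<circ> inv_into D \<phi>"
  have "smooth_on ?F (ball (\<phi> p) r)"
    by (rule smooth_on_subset[OF smooth_funD[OF W(3) c] r(2)])
  then obtain h where h: "\<And>b. smooth_on (h b) (ball (\<phi> p) r)"
    and e: "\<And>x. x \<in> ball (\<phi> p) r \<Longrightarrow> ?F x = ?F (\<phi> p) + (\<Sum>b\<in>Basis. ((x - \<phi> p) \<bullet> b) * h b x)"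
    and d: "\<And>b. h b (\<phi> p) = frechet_derivative ?F (at (\<phi> p)) b"
    by (rule hadamard) blast
  let ?B = "{q \<in> D. \<phi> q \<in> ball (\<phi> p) r}"
  have B: "openin (mtop M) ?B" "p \<in> ?B"
    using chart_open_preimage[OF c open_ball] p r by auto
  let ?y = "\<lambda>b q. \<phi> q \<bullet> b" and ?h = "\<lambda>b q. h b (\<phi> q)"
  have y: "smooth_near M p (?y b)" for b
    using smooth_nearI[OF chart_openin[OF c] p smooth_fun_coordinate[OF c]] .
  have y': "smooth_near M p (\<lambda>q. ?y b q - ?y b p)" for b
    using smooth_near_add[OF y smooth_near_const[OF pt], of b "- ?y b p"] by simp
  have sh: "smooth_near M p (?h b)" for b
  proof (rule smooth_nearI[OF B smooth_fun_coordinates[OF c B(1)]])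
    show "smooth_on (h b) (\<phi> ` ?B)" by (rule smooth_on_subset[OF h]) auto
  qed auto
  have t: "smooth_near M p (\<lambda>q. (?y b q - ?y b p) * ?h b q)" for b
    using smooth_near_mult[OF y' sh] .
  have ts: "smooth_near M p (\<lambda>q. \<Sum>b\<in>Basis. (?y b q - ?y b p) * ?h b q)"
    "v (\<lambda>q. \<Sum>b\<in>Basis. (?y b q - ?y b p) * ?h b q) = (\<Sum>b\<in>Basis. v (\<lambda>q. (?y b q - ?y b p) * ?h b q))"
    using tangent_sum[OF v pt, of Basis "\<lambda>b q. (?y b q - ?y b p) * ?h b q"] t by blast+
  have "v f = v (\<lambda>q. f p + (\<Sum>b\<in>Basis. (?y b q - ?y b p) * ?h b q))"
  proof (rule tangent_cong[OF v B])
    fix q assume "q \<in> ?B"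
    then show "f q = f p + (\<Sum>b\<in>Basis. (?y b q - ?y b p) * ?h b q)"
      using e[of "\<phi> q"] c p by (simp add: inner_diff_left)
  qed
  also have "\<dots> = v (\<lambda>q. f p) + v (\<lambda>q. \<Sum>b\<in>Basis. (?y b q - ?y b p) * ?h b q)"
    by (rule tangent_add[OF v smooth_near_const[OF pt] ts(1)])
  also have "\<dots> = (\<Sum>b\<in>Basis. v (\<lambda>q. (?y b q - ?y b p) * ?h b q))"
    using ts(2) tangent_const[OF v pt] by simp
  also have "\<dots> = (\<Sum>b\<in>Basis. v (\<lambda>q. ?y b q - ?y b p) * ?h b p)"
    using tangent_mult[OF v y' sh] by simp
  also have "\<dots> = (\<Sum>b\<in>Basis. v (?y b) * coordinate_field D \<phi> b p f)"
    using tangent_diff[OF v y smooth_near_const[OF pt]] tangent_const[OF v pt] True d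
    by (simp add: coordinate_field_def)
  finally show ?thesis .
qed

text \<open>Components turn dimension counts in a tangent space into dimension counts in the model space.\<close>

definition chart_components :: "('a \<Rightarrow> 'e) \<Rightarrow> 'a tangent \<Rightarrow> 'e" where
  "chart_components \<phi> v = (\<Sum>b\<in>Basis. v (\<lambda>q. \<phi> q \<bullet> b) *\<^sub>R b)"

lemma chart_components_inner: "b \<in> Basis \<Longrightarrow> chart_components \<phi> v \<bullet> b = v (\<lambda>q. \<phi> q \<bullet> b)"
  by (simp add: chart_components_def inner_sum_left inner_Basis if_distrib cong: if_cong)

lemma chart_components_add: "chart_components \<phi> (u + v) = chart_components \<phi> u + chart_components \<phi> v"
  by (simp add: chart_components_def scaleR_add_left sum.distrib)

lemma chart_components_scale: "chart_components \<phi> (\<lambda>f. a * v f) = a *\<^sub>R chart_components \<phi> v"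
  by (simp add: chart_components_def scaleR_sum_right)

lemma chart_components_inject:
  assumes "(D, \<phi>) \<in> atlas M" "p \<in> D" "u \<in> tangent_space M p" "v \<in> tangent_space M p"
    and "chart_components \<phi> u = chart_components \<phi> v"
  shows "u = v"
proof
  fix f
  show "u f = v f"
    unfolding tangent_expand[OF assms(1,2,3), of f] tangent_expand[OF assms(1,2,4), of f]
    using chart_components_inner[of _ \<phi> u] chart_components_inner[of _ \<phi> v] assms(5) by (intro sum.cong) auto
qed

lemma chart_components_coordinate_field:
  "(D, \<phi>) \<in> atlas M \<Longrightarrow> p \<in> D \<Longrightarrow> b \<in> Basis \<Longrightarrow> chart_components \<phi> (coordinate_field D \<phi> b p) = b"
  unfolding chart_components_def
  by (simp add: coordinate_field_coordinate inner_Basis if_distrib[of "\<lambda>t. t *\<^sub>R _"] cong: if_cong)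

end

section \<open>Levi-Civita connection and the symmetries of its curvature\<close>

locale riemannian_mfd = smooth_mfd M for M :: "('a, 'e::euclidean_space) manifold" +
  fixes g :: "'a metric_tensor" and nabla :: "'a connection"
  assumes metric: "riemannian_metric M g" and lc: "levi_civita M g nabla"
begin

lemma g_sym: "p \<in> topspace (mtop M) \<Longrightarrow> u \<in> tangent_space M p \<Longrightarrow> v \<in> tangent_space M p \<Longrightarrow> g p u v = g p v u"
  and g_add_left: "p \<in> topspace (mtop M) \<Longrightarrow> u \<in> tangent_space M p \<Longrightarrow> v \<in> tangent_space M p \<Longrightarrow>
    w \<in> tangent_space M p \<Longrightarrow> g p (u + v) w = g p u w + g p v w"
  and g_scale_left: "p \<in> topspace (mtop M) \<Longrightarrow> u \<in> tangent_space M p \<Longrightarrow> v \<in> tangent_space M p \<Longrightarrow>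
    g p (\<lambda>f. a * u f) v = a * g p u v"
  and g_pos: "p \<in> topspace (mtop M) \<Longrightarrow> u \<in> tangent_space M p \<Longrightarrow> u \<noteq> 0 \<Longrightarrow> g p u u > 0"
  using conjunct1[OF metric[unfolded riemannian_metric_def], rule_format, of p] by simp_all

lemma ip_cong: "u p = u' p \<Longrightarrow> v p = v' p \<Longrightarrow> ip g u v p = ip g u' v' p"
  by (simp add: ip_def)

lemma ip_smooth: "openin (mtop M) W \<Longrightarrow> vector_field M W u \<Longrightarrow> vector_field M W v \<Longrightarrow> smooth_fun M W (ip g u v)"
  using conjunct2[OF metric[unfolded riemannian_metric_def]] by simp

lemma connection_rules:
  assumes "openin (mtop M) W" "vector_field M W u" "vector_field M W v" "vector_field M W w"
    "smooth_fun M W f"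
  shows "vector_field M W (nabla u v)"
    and "p \<in> W \<Longrightarrow> nabla (u + v) w p = nabla u w p + nabla v w p"
    and "p \<in> W \<Longrightarrow> nabla (vscale f u) v p = vscale f (nabla u v) p"
    and "p \<in> W \<Longrightarrow> nabla u (v + w) p = nabla u v p + nabla u w p"
    and "p \<in> W \<Longrightarrow> nabla u (vscale f v) p = vscale (dird u f) v p + vscale f (nabla u v) p"
  using lc[unfolded levi_civita_def affine_connection_def, THEN conjunct1, rule_format, OF assms] by simp_all

lemma levi_civita_rules:
  assumes "openin (mtop M) W" "vector_field M W u" "vector_field M W v" "vector_field M W w" "p \<in> W"
  shows "nabla u v p - nabla v u p = bracket M u v p"
    and "dird u (ip g v w) p = ip g (nabla u v) w p + ip g v (nabla u w) p"
  using lc[unfolded levi_civita_def, THEN conjunct2, rule_format, OF assms] by simp_all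

context
  fixes W assumes W: "openin (mtop M) W"
begin

lemma in_topspace: "p \<in> W \<Longrightarrow> p \<in> topspace (mtop M)"
  using openin_subset[OF W] by blast

lemma ip_sym: "vector_field M W u \<Longrightarrow> vector_field M W v \<Longrightarrow> p \<in> W \<Longrightarrow> ip g u v p = ip g v u p"
  using g_sym[OF in_topspace vector_field_tangent vector_field_tangent] by (simp add: ip_def)

lemma ip_add_left:
  "vector_field M W u \<Longrightarrow> vector_field M W v \<Longrightarrow> vector_field M W w \<Longrightarrow> p \<in> W \<Longrightarrow>
    ip g (u + v) w p = ip g u w p + ip g v w p"
  using g_add_left[OF in_topspace vector_field_tangent vector_field_tangent vector_field_tangent]
  by (simp add: ip_def)

lemma ip_diff_left:
  assumes "vector_field M W u" "vector_field M W v" "vector_field M W w" "p \<in> W"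
  shows "ip g (u - v) w p = ip g u w p - ip g v w p"
  using ip_add_left[OF vector_field_diff[OF W assms(1,2)] assms(2,3,4)] by simp

lemma nabla_field: "vector_field M W u \<Longrightarrow> vector_field M W v \<Longrightarrow> vector_field M W (nabla u v)"
  using connection_rules(1)[OF W _ _ _ smooth_fun_const[OF W]] by blast

lemma nabla_add_left:
  "vector_field M W u \<Longrightarrow> vector_field M W v \<Longrightarrow> vector_field M W w \<Longrightarrow> p \<in> W \<Longrightarrow>
    nabla (u + v) w p = nabla u w p + nabla v w p"
  using connection_rules(2)[OF W _ _ _ smooth_fun_const[OF W]] by blast

lemma nabla_add_right:
  "vector_field M W u \<Longrightarrow> vector_field M W v \<Longrightarrow> vector_field M W w \<Longrightarrow> p \<in> W \<Longrightarrow>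
    nabla u (v + w) p = nabla u v p + nabla u w p"
  using connection_rules(4)[OF W _ _ _ smooth_fun_const[OF W]] by blast

lemma nabla_diff_left:
  assumes "vector_field M W u" "vector_field M W v" "vector_field M W w" "p \<in> W"
  shows "nabla (u - v) w p = nabla u w p - nabla v w p"
  using nabla_add_left[OF vector_field_diff[OF W assms(1,2)] assms(2,3,4)] by simp

lemma nabla_diff_right:
  assumes "vector_field M W u" "vector_field M W v" "vector_field M W w" "p \<in> W"
  shows "nabla u (v - w) p = nabla u v p - nabla u w p"
  using nabla_add_right[OF assms(1) vector_field_diff[OF W assms(2,3)] assms(3,4)] by simp

text \<open>The connection is tensorial in its first slot and a derivation in the second, so it vanishes on
  fields that vanish near \<open>p\<close>, again by multiplying with a function that vanishes near \<open>p\<close>.\<close>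

lemma nabla_zero:
  assumes u: "vector_field M W u" and v: "vector_field M W v" and p: "p \<in> W"
    and z: "(\<forall>q\<in>W. u q = 0) \<or> (\<forall>q\<in>W. v q = 0)"
  shows "nabla u v p = 0"
proof -
  define bump :: "'a \<Rightarrow> real" where "bump q = (if q \<in> W then 0 else 1)" for q
  have bump: "smooth_fun M W bump"
    by (rule smooth_fun_cong[OF W _ smooth_fun_const[OF W, of 0]]) (simp add: bump_def)
  have scale: "vscale bump w = w" if "\<forall>q\<in>W. w q = 0" for w
    using that by (auto simp: vscale_def bump_def fun_eq_iff)
  from z show ?thesis
  proof
    assume z: "\<forall>q\<in>W. u q = 0"
    then show ?thesis
      using connection_rules(3)[OF W u v v bump p, unfolded scale[OF z]] p
      by (simp add: vscale_def[of bump "nabla u v"] bump_def zero_fun_def)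
  next
    assume z: "\<forall>q\<in>W. v q = 0"
    then show ?thesis
      using connection_rules(5)[OF W u v v bump p, unfolded scale[OF z]] p
      by (simp add: vscale_def[of bump "nabla u v"] vscale_def[of "dird u bump" v] bump_def
          zero_fun_def plus_fun_def)
  qed
qed

lemma nabla_cong:
  assumes u: "vector_field M W u" and v: "vector_field M W v" and p: "p \<in> W"
    and eq: "\<And>q. q \<in> W \<Longrightarrow> u q = u' q" "\<And>q. q \<in> W \<Longrightarrow> v q = v' q"
  shows "nabla u v p = nabla u' v' p"
proof -
  have u': "vector_field M W u'" and v': "vector_field M W v'"
    using vector_field_cong u v eq by blast+
  have "nabla (u - u') v p = 0" "nabla u' (v - v') p = 0"
    using nabla_zero[OF vector_field_diff[OF W u u'] v p] nabla_zero[OF u' vector_field_diff[OF W v v'] p] eq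
    by auto
  then show ?thesis
    using nabla_diff_left[OF u u' v p] nabla_diff_right[OF u' v v' p] by simp
qed

lemma torsion_free:
  "vector_field M W u \<Longrightarrow> vector_field M W v \<Longrightarrow> p \<in> W \<Longrightarrow> bracket M u v p = nabla u v p - nabla v u p"
  using levi_civita_rules(1)[OF W] by metis

lemma metric_compatible:
  "vector_field M W u \<Longrightarrow> vector_field M W v \<Longrightarrow> vector_field M W w \<Longrightarrow> p \<in> W \<Longrightarrow>
    dird u (ip g v w) p = ip g (nabla u v) w p + ip g v (nabla u w) p"
  using levi_civita_rules(2)[OF W] by blast

lemma bracket_field:
  assumes "vector_field M W u" "vector_field M W v"
  shows "vector_field M W (bracket M u v)"
  by (rule vector_field_cong[OF vector_field_diff[OF W nabla_field[OF assms] nabla_field[OF assms(2,1)]]])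
    (simp add: torsion_free[OF assms])

lemma bracket_swap: "bracket M v u = - bracket M u v"
  by (simp add: bracket_def fun_eq_iff)

lemma bracket_apply: "smooth_near M p f \<Longrightarrow> bracket M u v p f = u p (dird v f) - v p (dird u f)"
  by (simp add: bracket_def)

lemma jacobi:
  assumes u: "vector_field M W u" and v: "vector_field M W v" and w: "vector_field M W w" and p: "p \<in> W"
  shows "bracket M u (bracket M v w) p + bracket M v (bracket M w u) p + bracket M w (bracket M u v) p = 0"
proof
  fix f
  have expand: "bracket M u (bracket M v w) p f =
      u p (dird v (dird w f)) - u p (dird w (dird v f)) - v p (dird w (dird u f)) + w p (dird v (dird u f))"
    if f: "smooth_near M p f" and u: "vector_field M W u" and v: "vector_field M W v" and w: "vector_field M W w"
    for u v w
  proof -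
    obtain V where V: "openin (mtop M) V" "p \<in> V" "smooth_fun M V f"
      using f unfolding smooth_near_def by blast
    have near: "smooth_near M p (dird a (dird b f))" if "vector_field M W a" "vector_field M W b" for a b
      using dird_smooth_near[OF W] that p f by blast
    have "u p (dird (bracket M v w) f) = u p (\<lambda>q. dird v (dird w f) q - dird w (dird v f) q)"
      by (rule tangent_cong[OF vector_field_tangent[OF u p] V(1,2)])
        (simp add: dird_def bracket_apply[OF smooth_nearI[OF V(1) _ V(3)]])
    also have "\<dots> = u p (dird v (dird w f)) - u p (dird w (dird v f))"
      by (rule tangent_diff[OF vector_field_tangent[OF u p] near[OF v w] near[OF w v]])
    finally show ?thesis
      using f bracket_apply[OF dird_smooth_near[OF W u p f], of v w]
      by (simp add: bracket_apply[of p f u])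
  qed
  show "(bracket M u (bracket M v w) p + bracket M v (bracket M w u) p + bracket M w (bracket M u v) p) f = 0 f"
  proof (cases "smooth_near M p f")
    case True
    then show ?thesis using expand[OF True u v w] expand[OF True v w u] expand[OF True w u v] by simp
  next
    case False
    then show ?thesis by (simp add: bracket_def)
  qed
qed

definition curvature :: "'a vfield \<Rightarrow> 'a vfield \<Rightarrow> 'a vfield \<Rightarrow> 'a vfield" where
  "curvature u v w = nabla u (nabla v w) - nabla v (nabla u w) - nabla (bracket M u v) w"

lemma riemann_curvature: "riemann M g nabla u v w z p = ip g (curvature u v w) z p"
  by (simp add: riemann_def curvature_def)

lemma curvature_apply:
  "curvature u v w p = nabla u (nabla v w) p - nabla v (nabla u w) p - nabla (bracket M u v) w p"
  by (simp add: curvature_def)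

lemma curvature_field:
  "vector_field M W u \<Longrightarrow> vector_field M W v \<Longrightarrow> vector_field M W w \<Longrightarrow> vector_field M W (curvature u v w)"
  unfolding curvature_def by (intro vector_field_diff[OF W] nabla_field bracket_field)

lemma nabla_bracket_swap:
  assumes "vector_field M W u" "vector_field M W v" "vector_field M W w" "p \<in> W"
  shows "nabla (bracket M v u) w p = - nabla (bracket M u v) w p"
proof -
  have "nabla (0 - bracket M u v) w p = nabla 0 w p - nabla (bracket M u v) w p"
    by (rule nabla_diff_left[OF vector_field_0 bracket_field[OF assms(1,2)] assms(3,4)])
  moreover have "nabla 0 w p = 0"
    by (rule nabla_zero[OF vector_field_0 assms(3,4)]) simp
  ultimately show ?thesis by (simp add: bracket_swap[of v u])
qed

lemma curvature_swap:
  assumes "vector_field M W u" "vector_field M W v" "vector_field M W w" "p \<in> W"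
  shows "curvature v u w p = - curvature u v w p"
  using nabla_bracket_swap[OF assms] by (simp add: curvature_apply)

text \<open>Metric compatibility turns the commutator of second derivatives of \<open>\<langle>w, z\<rangle>\<close>, which is its
  derivative along \<open>[u, v]\<close>, into the skew symmetry of the curvature in its last two slots.\<close>

lemma riemann_skew34:
  assumes u: "vector_field M W u" and v: "vector_field M W v" and w: "vector_field M W w"
    and z: "vector_field M W z" and p: "p \<in> W"
  shows "riemann M g nabla u v z w p = - riemann M g nabla u v w z p"
proof -
  have second: "u p (dird v (ip g w z)) =
      ip g (nabla u (nabla v w)) z p + ip g (nabla v w) (nabla u z) p +
      (ip g (nabla u w) (nabla v z) p + ip g w (nabla u (nabla v z)) p)"
    if u: "vector_field M W u" and v: "vector_field M W v" for u v
  proof -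
    have near: "smooth_near M p (ip g a b)" if "vector_field M W a" "vector_field M W b" for a b
      using smooth_nearI[OF W p ip_smooth[OF W that]] .
    have "u p (dird v (ip g w z)) = u p (\<lambda>q. ip g (nabla v w) z q + ip g w (nabla v z) q)"
      by (rule tangent_cong[OF vector_field_tangent[OF u p] W p])
        (simp add: metric_compatible[OF v w z])
    also have "\<dots> = dird u (ip g (nabla v w) z) p + dird u (ip g w (nabla v z)) p"
      unfolding dird_def
      by (intro tangent_add[OF vector_field_tangent[OF u p]] near nabla_field u v w z)
    finally show ?thesis
      using metric_compatible[OF u nabla_field[OF v w] z p] metric_compatible[OF u w nabla_field[OF v z] p]
      by simp
  qed
  have "bracket M u v p (ip g w z) = u p (dird v (ip g w z)) - v p (dird u (ip g w z))"
    using bracket_apply[OF smooth_nearI[OF W p ip_smooth[OF W w z]]] .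
  moreover have "bracket M u v p (ip g w z) = ip g (nabla (bracket M u v) w) z p + ip g w (nabla (bracket M u v) z) p"
    using metric_compatible[OF bracket_field[OF u v] w z p] by (simp add: dird_def)
  moreover have "ip g (curvature u v w) z p =
      ip g (nabla u (nabla v w)) z p - ip g (nabla v (nabla u w)) z p - ip g (nabla (bracket M u v) w) z p"
    if "vector_field M W w" "vector_field M W z" for w z
    unfolding curvature_def using u v that p
    by (simp add: ip_diff_left vector_field_diff[OF W] nabla_field bracket_field)
  ultimately show ?thesis
    using second[OF u v] second[OF v u] ip_sym[OF _ _ p] u v w z
    by (simp add: riemann_curvature nabla_field bracket_field)
qed

lemma nabla_bracket:
  assumes u: "vector_field M W u" and v: "vector_field M W v" and w: "vector_field M W w" and p: "p \<in> W"
  shows "nabla u (bracket M v w) p = nabla u (nabla v w) p - nabla u (nabla w v) p"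
proof -
  have "nabla u (bracket M v w) p = nabla u (nabla v w - nabla w v) p"
    by (rule nabla_cong[OF u bracket_field[OF v w] p]) (simp_all add: torsion_free[OF v w])
  then show ?thesis
    using nabla_diff_right[OF u nabla_field[OF v w] nabla_field[OF w v] p] by simp
qed

lemma first_bianchi:
  assumes u: "vector_field M W u" and v: "vector_field M W v" and w: "vector_field M W w" and p: "p \<in> W"
  shows "curvature u v w p + curvature v w u p + curvature w u v p = 0"
proof -
  have "curvature u v w p + curvature v w u p + curvature w u v p =
      (nabla u (bracket M v w) p - nabla (bracket M v w) u p) +
      (nabla v (bracket M w u) p - nabla (bracket M w u) v p) +
      (nabla w (bracket M u v) p - nabla (bracket M u v) w p)"
    unfolding nabla_bracket[OF u v w p] nabla_bracket[OF v w u p] nabla_bracket[OF w u v p]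
    by (simp add: curvature_apply)
  also have "\<dots> = bracket M u (bracket M v w) p + bracket M v (bracket M w u) p + bracket M w (bracket M u v) p"
    using torsion_free[OF u bracket_field[OF v w] p] torsion_free[OF v bracket_field[OF w u] p]
      torsion_free[OF w bracket_field[OF u v] p] by simp
  finally show ?thesis using jacobi[OF u v w p] by simp
qed

lemma ip_zero: "vector_field M W v \<Longrightarrow> p \<in> W \<Longrightarrow> u p = 0 \<Longrightarrow> ip g u v p = 0"
  using ip_diff_left[OF vector_field_0 vector_field_0, of v p] ip_cong[of u p 0 v v] by simp

lemma riemann_skew12:
  assumes u: "vector_field M W u" and v: "vector_field M W v" and w: "vector_field M W w"
    and z: "vector_field M W z" and p: "p \<in> W"
  shows "riemann M g nabla v u w z p = - riemann M g nabla u v w z p"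
proof -
  have "ip g (curvature v u w + curvature u v w) z p = 0"
    by (rule ip_zero[OF z p]) (simp add: curvature_swap[OF u v w p])
  then show ?thesis
    using ip_add_left[OF curvature_field[OF v u w] curvature_field[OF u v w] z p]
    by (simp add: riemann_curvature)
qed

lemma riemann_cyclic:
  assumes u: "vector_field M W u" and v: "vector_field M W v" and w: "vector_field M W w"
    and z: "vector_field M W z" and p: "p \<in> W"
  shows "riemann M g nabla u v w z p + riemann M g nabla v w u z p + riemann M g nabla w u v z p = 0"
proof -
  have "ip g (curvature u v w + curvature v w u + curvature w u v) z p = 0"
    by (rule ip_zero[OF z p]) (use first_bianchi[OF u v w p] in simp)
  then show ?thesis
    using u v w z p by (simp add: riemann_curvature ip_add_left vector_field_add curvature_field)
qed

text \<open>Adding the first Bianchi identity over the four ways of leaving one argument fixed, everything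
  cancels by skew symmetry except twice the difference of the two sides.\<close>

lemma riemann_pair_symmetry:
  assumes u: "vector_field M W u" and v: "vector_field M W v" and w: "vector_field M W w"
    and z: "vector_field M W z" and p: "p \<in> W"
  shows "riemann M g nabla w z u v p = riemann M g nabla u v w z p"
  using riemann_cyclic[OF z u w v p] riemann_cyclic[OF u w v z p]
    riemann_cyclic[OF w v z u p] riemann_cyclic[OF v z u w p]
    riemann_skew34[OF u w v z p] riemann_skew34[OF w v z u p] riemann_skew34[OF v z u w p]
    riemann_skew34[OF z u v w p] riemann_skew12[OF u v w z p] riemann_skew12[OF w z v u p]
    riemann_skew34[OF w z u v p] riemann_skew34[OF u v w z p]
  by linarith

text \<open>The second Bianchi identity for vector fields, before the covariant derivative of the curvature
  is split off: the Jacobi identity for the operators \<open>nabla u\<close>, \<open>nabla v\<close>, \<open>nabla w\<close> together with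
  that for the fields. Summed over the cyclic permutations, the bracket terms stand in for the
  derivatives of the first two arguments of the curvature.\<close>

lemma second_bianchi:
  assumes u: "vector_field M W u" and v: "vector_field M W v" and w: "vector_field M W w"
    and z: "vector_field M W z" and p: "p \<in> W"
  shows "(nabla u (curvature v w z) p - curvature v w (nabla u z) p + curvature u (bracket M v w) z p) +
    (nabla v (curvature w u z) p - curvature w u (nabla v z) p + curvature v (bracket M w u) z p) +
    (nabla w (curvature u v z) p - curvature u v (nabla w z) p + curvature w (bracket M u v) z p) = 0"
proof -
  have one: "nabla u (curvature v w z) p - curvature v w (nabla u z) p + curvature u (bracket M v w) z p =
     nabla u (nabla v (nabla w z)) p - nabla u (nabla w (nabla v z)) p
     - nabla v (nabla w (nabla u z)) p + nabla w (nabla v (nabla u z)) p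
     - nabla (bracket M u (bracket M v w)) z p"
    if u: "vector_field M W u" and v: "vector_field M W v" and w: "vector_field M W w" for u v w
  proof -
    have "nabla u (curvature v w z) p = nabla u (nabla v (nabla w z)) p - nabla u (nabla w (nabla v z)) p
       - nabla u (nabla (bracket M v w) z) p"
      unfolding curvature_def using u v w z p
      by (simp add: nabla_diff_right vector_field_diff[OF W] nabla_field bracket_field)
    then show ?thesis by (simp add: curvature_apply algebra_simps)
  qed
  let ?J = "bracket M u (bracket M v w) + bracket M v (bracket M w u) + bracket M w (bracket M u v)"
  have "nabla ?J z p = 0"
    by (rule nabla_zero[OF _ z p]) (use u v w jacobi[OF u v w] in \<open>simp_all add: vector_field_add bracket_field\<close>)
  then have "nabla (bracket M u (bracket M v w)) z p + nabla (bracket M v (bracket M w u)) z p +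
      nabla (bracket M w (bracket M u v)) z p = 0"
    using u v w z p by (simp add: nabla_add_left vector_field_add bracket_field)
  then show ?thesis
    unfolding one[OF u v w] one[OF v w u] one[OF w u v] by (simp add: algebra_simps)
qed

end

end

section \<open>Orthonormal frames of 3-manifolds\<close>

context riemannian_mfd
begin

lemma open_positive:
  assumes W: "openin (mtop M) W" and c: "(D, \<phi>) \<in> atlas M" and f: "smooth_fun M W f"
  shows "openin (mtop M) {q \<in> D \<inter> W. f q > 0}"
proof -
  let ?F = "f \<circ> inv_into D \<phi>" and ?S = "\<phi> ` (D \<inter> W)"
  have "Ck_on 0 ?F ?S"
    using smooth_funD[OF f c] unfolding smooth_on_def by blast
  then have "continuous_on ?S ?F" by simp
  then have "open (?S \<inter> ?F -` {0<..})"
    by (rule continuous_open_preimage[OF _ chart_open_image[OF c W] open_greaterThan])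
  then have "openin (mtop M) {q \<in> D. \<phi> q \<in> ?S \<inter> ?F -` {0<..}}"
    by (rule chart_open_preimage[OF c])
  moreover have "\<phi> q \<in> ?S \<inter> ?F -` {0<..} \<longleftrightarrow> q \<in> W \<and> f q > 0" if "q \<in> D" for q
    using inj_on_image_mem_iff[OF chart_inj[OF c] that, of "D \<inter> W"] chart_inv[OF c that] that by simp
  then have "{q \<in> D. \<phi> q \<in> ?S \<inter> ?F -` {0<..}} = {q \<in> D \<inter> W. f q > 0}"
    by blast
  ultimately show ?thesis by simp
qed

context
  fixes W assumes W: "openin (mtop M) W"
begin

lemma ip_scale_left:
  assumes "vector_field M W u" "vector_field M W v" "p \<in> W"
  shows "ip g (vscale f u) v p = f p * ip g u v p"
  using g_scale_left[OF in_topspace[OF W assms(3)] vector_field_tangent[OF assms(1,3)]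
      vector_field_tangent[OF assms(2,3)]]
  by (simp add: ip_def vscale_def)

lemma ip_scale_right:
  assumes "vector_field M W u" "vector_field M W v" "smooth_fun M W f" "p \<in> W"
  shows "ip g v (vscale f u) p = f p * ip g v u p"
  using ip_scale_left[OF assms(1,2,4), of f] ip_sym[OF W assms(2) _ assms(4)] assms
  by (simp add: vector_field_vscale)

lemma ip_diff_right:
  assumes "vector_field M W u" "vector_field M W v" "vector_field M W w" "p \<in> W"
  shows "ip g w (u - v) p = ip g w u p - ip g w v p"
  using ip_diff_left[OF W assms] ip_sym[OF W assms(3) _ assms(4)] assms
  by (simp add: vector_field_diff[OF W])

text \<open>This will be applied to the members of an orthonormal frame, whose products are constant.\<close>

lemma constant_product:
  assumes "vector_field M W u" "vector_field M W a" "vector_field M W b" "p \<in> W"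
    and "\<And>q. q \<in> W \<Longrightarrow> ip g a b q = c"
  shows "ip g (nabla u a) b p + ip g a (nabla u b) p = 0"
proof -
  have "u p (ip g a b) = u p (\<lambda>q. c)"
    by (rule tangent_cong[OF vector_field_tangent[OF assms(1,4)] W assms(4,5)])
  then show ?thesis
    using metric_compatible[OF W assms(1-4)] in_topspace[OF W assms(4)]
      tangent_const[OF vector_field_tangent[OF assms(1,4)]] by (simp add: dird_def)
qed

text \<open>Vanishing torsion replaces the brackets in Killing's equation by covariant derivatives, and metric
  compatibility cancels those along \<open>k\<close>.\<close>

lemma lie_derivative_metric:
  assumes k: "vector_field M W k" and u: "vector_field M W u" and v: "vector_field M W v" and p: "p \<in> W"
  shows "dird k (ip g u v) p - ip g (bracket M k u) v p - ip g u (bracket M k v) p =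
    ip g (nabla u k) v p + ip g u (nabla v k) p"
proof -
  have "ip g (bracket M k u) v p = ip g (nabla k u - nabla u k) v p"
    "ip g u (bracket M k v) p = ip g u (nabla k v - nabla v k) p"
    by (simp_all add: ip_def torsion_free[OF W] k u v p)
  then show ?thesis
    using metric_compatible[OF W k u v p] k u v p
    by (simp add: ip_diff_left[OF W] ip_diff_right nabla_field[OF W])
qed

end

end

locale riemannian_3mfd = riemannian_mfd M g nabla
  for M :: "('a, real^3) manifold" and g :: "'a metric_tensor" and nabla :: "'a connection"
begin

lemma orthonormal_frame_iff:
  "orthonormal_frame M g W [k, x, y] \<longleftrightarrow>
    vector_field M W k \<and> vector_field M W x \<and> vector_field M W y \<and>
    (\<forall>p\<in>W. ip g k k p = 1 \<and> ip g x x p = 1 \<and> ip g y y p = 1 \<and> ip g k x p = 0 \<and> ip g x k p = 0 \<and>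
      ip g k y p = 0 \<and> ip g y k p = 0 \<and> ip g x y p = 0 \<and> ip g y x p = 0)"
  unfolding orthonormal_frame_def by (auto simp: less_Suc_eq numeral_3_eq_3)

text \<open>A Gram-Schmidt step. Two vectors do not span the three-dimensional tangent space, so some
  coordinate field stays nonzero after its components along \<open>a\<close> and \<open>b\<close> are removed. The case
  \<open>b = 0\<close> serves to find the second vector of a frame.\<close>

lemma unit_normal_field:
  assumes W: "openin (mtop M) W" and p: "p \<in> W"
    and a: "vector_field M W a" and b: "vector_field M W b"
    and aa: "\<And>q. q \<in> W \<Longrightarrow> ip g a a q = 1"
    and bb: "\<And>q. q \<in> W \<Longrightarrow> ip g b b q = 1 \<or> b q = 0"
    and ab: "\<And>q. q \<in> W \<Longrightarrow> ip g a b q = 0"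
  obtains V y where "openin (mtop M) V" "p \<in> V" "V \<subseteq> W" "vector_field M V y"
    "\<And>q. q \<in> V \<Longrightarrow> ip g y y q = 1 \<and> ip g y a q = 0 \<and> ip g y b q = 0"
proof -
  obtain D \<phi> where c: "(D, \<phi>) \<in> atlas M" and pD: "p \<in> D"
    using chart_at[OF in_topspace[OF W p]] by blast
  define W' where "W' = D \<inter> W"
  have W': "openin (mtop M) W'" "p \<in> W'" "W' \<subseteq> W" "W' \<subseteq> D"
    using openin_Int[OF chart_openin[OF c] W] p pD by (auto simp: W'_def)
  have a': "vector_field M W' a" and b': "vector_field M W' b"
    using vector_field_subset a b W' by blast+
  define E where "E i = coordinate_field D \<phi> i" for i
  have E: "vector_field M W' (E i)" for i
    unfolding E_def by (rule vector_field_subset[OF coordinate_field_vector_field[OF c] W'(4)])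
  define u where "u i = E i - vscale (ip g (E i) a) a - vscale (ip g (E i) b) b" for i
  have va: "vector_field M W' (vscale (ip g (E i) a) a)" and vb: "vector_field M W' (vscale (ip g (E i) b) b)" for i
    by (intro vector_field_vscale a' b' ip_smooth[OF W'(1)] E)+
  have u: "vector_field M W' (u i)" for i
    unfolding u_def by (intro vector_field_diff[OF W'(1)] E va vb)
  have ip_u: "ip g (u i) w q = ip g (E i) w q - ip g (E i) a q * ip g a w q - ip g (E i) b q * ip g b w q"
    if "vector_field M W' w" "q \<in> W'" for i w q
    unfolding u_def using that E va vb a' b'
    by (simp add: ip_diff_left[OF W'(1)] vector_field_diff[OF W'(1)] ip_scale_left[OF W'(1)])
  have ua: "ip g (u i) a q = 0" and ub: "ip g (u i) b q = 0" if q: "q \<in> W'" for i q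
  proof -
    have qW: "q \<in> W" using q W' by blast
    show "ip g (u i) a q = 0"
      using ip_u[OF a' q] aa[OF qW] ab[OF qW] ip_sym[OF W'(1) a' b' q] by simp
    have "ip g (E i) b q = 0" if "b q = 0"
      using ip_zero[of W' "E i" q b] W'(1) E q that ip_sym[OF W'(1) E b' q] by simp
    then show "ip g (u i) b q = 0"
      using ip_u[OF b' q] bb[OF qW] ab[OF qW] by auto
  qed
  have "\<exists>i\<in>Basis. u i p \<noteq> 0"
  proof (rule ccontr)
    assume neg: "\<not> (\<exists>i\<in>Basis. u i p \<noteq> 0)"
    have "E i p = (\<lambda>f. ip g (E i) a p * a p f) + (\<lambda>f. ip g (E i) b p * b p f)" if "i \<in> Basis" for i
    proof
      fix f
      have "u i p f = 0" using neg that by simp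
      then show "E i p f = ((\<lambda>f. ip g (E i) a p * a p f) + (\<lambda>f. ip g (E i) b p * b p f)) f"
        by (simp add: u_def vscale_def)
    qed
    then have "chart_components \<phi> (E i p) = ip g (E i) a p *\<^sub>R chart_components \<phi> (a p)
        + ip g (E i) b p *\<^sub>R chart_components \<phi> (b p)" if "i \<in> Basis" for i
      using that by (simp only: chart_components_add chart_components_scale)
    then have "i \<in> span {chart_components \<phi> (a p), chart_components \<phi> (b p)}" if "i \<in> Basis" for i
      using that chart_components_coordinate_field[OF c pD that]
      by (simp add: E_def) (metis insertCI span_add span_base span_scale)
    then have "span Basis \<subseteq> span {chart_components \<phi> (a p), chart_components \<phi> (b p)}"
      by (intro span_minimal subsetI) auto
    then have "dim (UNIV :: (real^3) set) \<le> card {chart_components \<phi> (a p), chart_components \<phi> (b p)}"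
      by (intro span_card_ge_dim) auto
    also have "\<dots> \<le> 2" by (simp add: card_insert_if)
    finally show False by simp
  qed
  then obtain i where i: "u i p \<noteq> 0" by blast
  define f where "f = ip g (u i) (u i)"
  have f: "smooth_fun M W' f"
    unfolding f_def by (rule ip_smooth[OF W'(1) u u])
  have "f p > 0"
    unfolding f_def ip_def by (rule g_pos[OF in_topspace[OF W p] vector_field_tangent[OF u W'(2)] i])
  define V where "V = {q \<in> D \<inter> W'. f q > 0}"
  have V: "openin (mtop M) V" "p \<in> V" "V \<subseteq> W'"
    using open_positive[OF W'(1) c f] \<open>f p > 0\<close> W'(2) pD by (auto simp: V_def)
  define n where "n = (\<lambda>q. f q powr (- 1 / 2))"
  have n: "smooth_fun M V n"
    unfolding n_def by (rule smooth_fun_powr[OF V(1) smooth_fun_subset[OF f V(3)]]) (simp add: V_def)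
  have uV: "vector_field M V (u i)" by (rule vector_field_subset[OF u V(3)])
  have y: "vector_field M V (vscale n (u i))"
    by (rule vector_field_vscale[OF uV n])
  have nn: "n q * (n q * f q) = 1" if "q \<in> V" for q
  proof -
    have "f q > 0" using that by (simp add: V_def)
    then have "n q * n q * f q = f q powr (- 1) * f q"
      by (simp add: n_def powr_add[symmetric])
    then show ?thesis using \<open>f q > 0\<close> by (simp add: powr_minus)
  qed
  have ay: "vector_field M V a" "vector_field M V b"
    using vector_field_subset a' b' V(3) by blast+
  show ?thesis
  proof (rule that[OF V(1,2) _ y])
    show "V \<subseteq> W" using V(3) W'(3) by blast
    fix q assume q: "q \<in> V"
    then have q': "q \<in> W'" using V(3) by blast
    show "ip g (vscale n (u i)) (vscale n (u i)) q = 1 \<and> ip g (vscale n (u i)) a q = 0 \<and>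
        ip g (vscale n (u i)) b q = 0"
      using ua[OF q'] ub[OF q'] nn[OF q] y uV ay q n
      by (simp add: ip_scale_left[OF V(1)] ip_scale_right[OF V(1)] f_def)
  qed
qed

lemma orthonormal_frame_exists:
  assumes U: "openin (mtop M) U" and k: "unit_vector_field M g U k" and p: "p \<in> U"
  obtains W x y where "openin (mtop M) W" "p \<in> W" "W \<subseteq> U" "orthonormal_frame M g W [k, x, y]"
proof -
  have k: "vector_field M U k" and kk: "\<And>q. q \<in> U \<Longrightarrow> ip g k k q = 1"
    using k by (auto simp: unit_vector_field_def)
  have k0: "ip g k 0 q = 0" if "q \<in> U" for q
    using ip_diff_right[OF U vector_field_0 vector_field_0 k that] by simp
  obtain V x where V: "openin (mtop M) V" "p \<in> V" "V \<subseteq> U" and x: "vector_field M V x"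
    and xx: "\<And>q. q \<in> V \<Longrightarrow> ip g x x q = 1 \<and> ip g x k q = 0 \<and> ip g x 0 q = 0"
    by (rule unit_normal_field[OF U p k vector_field_0 kk _ k0]) auto
  have kV: "vector_field M V k" by (rule vector_field_subset[OF k V(3)])
  have kx: "ip g k x q = 0" if "q \<in> V" for q
    using xx[OF that] ip_sym[OF V(1) kV x that] by simp
  obtain W y where W: "openin (mtop M) W" "p \<in> W" "W \<subseteq> V" and y: "vector_field M W y"
    and yy: "\<And>q. q \<in> W \<Longrightarrow> ip g y y q = 1 \<and> ip g y k q = 0 \<and> ip g y x q = 0"
    by (rule unit_normal_field[OF V(1,2) kV x _ _ kx]) (use kk xx V in auto)
  have kW: "vector_field M W k" and xW: "vector_field M W x"
    using kV x W(3) vector_field_subset by blast+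
  have "orthonormal_frame M g W [k, x, y]"
    unfolding orthonormal_frame_iff
    using kW xW y yy xx kx kk V(3) W(3) ip_sym[OF W(1) kW y] ip_sym[OF W(1) xW y] by (auto 0 4 dest!: subsetD)
  then show ?thesis using that W V by blast
qed

text \<open>Three orthonormal vectors form a basis: the map from coefficients to tangent vectors, read in a
  chart, is an injective and hence surjective endomorphism of \<open>real^3\<close>.\<close>

lemma tangent_orthonormal_expand:
  assumes p: "p \<in> topspace (mtop M)"
    and T: "a \<in> tangent_space M p" "b \<in> tangent_space M p" "c \<in> tangent_space M p"
    and on: "g p a a = 1" "g p b b = 1" "g p c c = 1" "g p a b = 0" "g p a c = 0" "g p b c = 0"
    and t: "t \<in> tangent_space M p"
  shows "t = (\<lambda>f. g p t a * a f) + (\<lambda>f. g p t b * b f) + (\<lambda>f. g p t c * c f)"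
proof -
  obtain D \<phi> where chart: "(D, \<phi>) \<in> atlas M" "p \<in> D" using chart_at[OF p] by blast
  define L where "L v = (\<lambda>f. v$1 * a f) + (\<lambda>f. v$2 * b f) + (\<lambda>f. v$3 * c f)" for v :: "real^3"
  have LT: "L v \<in> tangent_space M p" for v
    unfolding L_def by (intro tangent_space_add tangent_space_scale T)
  have gL: "g p (L v) w = v$1 * g p a w + v$2 * g p b w + v$3 * g p c w" if "w \<in> tangent_space M p" for v w
    unfolding L_def using T that
    by (simp add: g_add_left[OF p] g_scale_left[OF p] tangent_space_add tangent_space_scale)
  have sym: "g p b a = 0" "g p c a = 0" "g p c b = 0"
    using on g_sym[OF p] T by metis+
  have L: "g p (L v) a = v$1" "g p (L v) b = v$2" "g p (L v) c = v$3" for v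
    using gL T on sym by simp_all
  let ?F = "\<lambda>v. chart_components \<phi> (L v)"
  have F: "?F v = v$1 *\<^sub>R chart_components \<phi> a + v$2 *\<^sub>R chart_components \<phi> b + v$3 *\<^sub>R chart_components \<phi> c" for v
    by (simp only: L_def chart_components_add chart_components_scale)
  have lin: "linear ?F"
    unfolding F by (intro linearI) (simp_all add: algebra_simps)
  have inj: "inj ?F"
  proof (rule injI)
    fix v w assume "?F v = ?F w"
    then have "L v = L w" by (rule chart_components_inject[OF chart LT LT])
    then have "v$1 = w$1 \<and> v$2 = w$2 \<and> v$3 = w$3" using L by metis
    then show "v = w" by (simp add: vec_eq_iff forall_3)
  qed
  obtain v where "?F v = chart_components \<phi> t"
    using linear_injective_imp_surjective[OF lin inj] by (metis surjD)
  then have "L v = t" by (rule chart_components_inject[OF chart LT t])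
  then have "t = L v" "g p t a = v$1" "g p t b = v$2" "g p t c = v$3" using L[of v] by simp_all
  then show ?thesis by (simp add: L_def)
qed

context
  fixes W k x y
  assumes W: "openin (mtop M) W" and frame: "orthonormal_frame M g W [k, x, y]"
begin

lemma frame_fields: "vector_field M W k" "vector_field M W x" "vector_field M W y"
  using frame unfolding orthonormal_frame_iff by blast+

lemma frame_products:
  assumes "p \<in> W"
  shows "ip g k k p = 1" "ip g x x p = 1" "ip g y y p = 1" "ip g k x p = 0" "ip g x k p = 0"
    "ip g k y p = 0" "ip g y k p = 0" "ip g x y p = 0" "ip g y x p = 0"
  using frame assms unfolding orthonormal_frame_iff by blast+

lemma frame_swap: "orthonormal_frame M g W [k, y, x]"
  using frame unfolding orthonormal_frame_iff by blast

lemma frame_expand: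
  assumes u: "vector_field M W u" and p: "p \<in> W"
  shows "u p = (vscale (ip g u k) k + vscale (ip g u x) x + vscale (ip g u y) y) p"
  using tangent_orthonormal_expand[OF in_topspace[OF W p] vector_field_tangent[OF frame_fields(1) p]
      vector_field_tangent[OF frame_fields(2) p] vector_field_tangent[OF frame_fields(3) p] _ _ _ _ _ _
      vector_field_tangent[OF u p]] frame_products[OF p]
  by (simp add: ip_def vscale_def)

lemma frame_vscale_fields:
  assumes "vector_field M W u"
  shows "vector_field M W (vscale (ip g u k) k)" "vector_field M W (vscale (ip g u x) x)"
    "vector_field M W (vscale (ip g u y) y)"
  by (intro vector_field_vscale ip_smooth[OF W] assms frame_fields)+

lemma parseval:
  assumes u: "vector_field M W u" and v: "vector_field M W v" and p: "p \<in> W"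
  shows "ip g u v p = ip g u k p * ip g v k p + ip g u x p * ip g v x p + ip g u y p * ip g v y p"
proof -
  have "ip g u v p = ip g (vscale (ip g u k) k + vscale (ip g u x) x + vscale (ip g u y) y) v p"
    by (rule ip_cong) (rule frame_expand[OF u p], rule refl)
  then show ?thesis
    using frame_vscale_fields[OF u] frame_fields v p ip_sym[OF W v _ p]
    by (simp add: ip_add_left[OF W] ip_scale_left[OF W] vector_field_add)
qed

lemma frame_zero:
  assumes u: "vector_field M W u" and p: "p \<in> W"
    and "ip g u k p = 0" "ip g u x p = 0" "ip g u y p = 0"
  shows "u p = 0"
  using frame_expand[OF u p] assms(3-5) by (simp add: vscale_def fun_eq_iff)

lemma nabla_frame:
  assumes u: "vector_field M W u" and v: "vector_field M W v" and w: "vector_field M W w" and p: "p \<in> W"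
  shows "ip g (nabla u v) w p = ip g u k p * ip g (nabla k v) w p + ip g u x p * ip g (nabla x v) w p +
    ip g u y p * ip g (nabla y v) w p"
proof -
  note s = frame_vscale_fields[OF u]
  have "nabla u v p = nabla (vscale (ip g u k) k + vscale (ip g u x) x + vscale (ip g u y) y) v p"
    by (rule nabla_cong[OF W u v p frame_expand[OF u] refl])
  also have "\<dots> = (vscale (ip g u k) (nabla k v) + vscale (ip g u x) (nabla x v) + vscale (ip g u y) (nabla y v)) p"
    using s v p connection_rules(3)[OF W _ v v ip_smooth[OF W u] p] frame_fields
    by (simp add: nabla_add_left[OF W] vector_field_add)
  finally have "ip g (nabla u v) w p =
      ip g (vscale (ip g u k) (nabla k v) + vscale (ip g u x) (nabla x v) + vscale (ip g u y) (nabla y v)) w p"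
    by (rule ip_cong) (rule refl)
  also have "\<dots> = ip g u k p * ip g (nabla k v) w p + ip g u x p * ip g (nabla x v) w p +
    ip g u y p * ip g (nabla y v) w p"
    using u v w p frame_fields
    by (simp add: ip_add_left[OF W] ip_scale_left[OF W] vector_field_add vector_field_vscale
        nabla_field[OF W] ip_smooth[OF W])
  finally show ?thesis .
qed

text \<open>The curvature is visibly tensorial in its last slot; its symmetries move the other slots there.\<close>

lemma riemann_frame4:
  assumes "vector_field M W u" "vector_field M W v" "vector_field M W w" "vector_field M W z" "p \<in> W"
  shows "riemann M g nabla u v w z p = ip g z k p * riemann M g nabla u v w k p +
    ip g z x p * riemann M g nabla u v w x p + ip g z y p * riemann M g nabla u v w y p"
  using parseval[OF curvature_field[OF W assms(1-3)] assms(4,5)]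
  by (simp add: riemann_curvature[OF W] mult.commute)

lemma riemann_frame3:
  assumes "vector_field M W u" "vector_field M W v" "vector_field M W w" "vector_field M W z" "p \<in> W"
  shows "riemann M g nabla u v w z p = ip g w k p * riemann M g nabla u v k z p +
    ip g w x p * riemann M g nabla u v x z p + ip g w y p * riemann M g nabla u v y z p"
  using riemann_frame4[OF assms(1,2,4,3,5)] riemann_skew34[OF W assms(1,2,4) _ assms(5)] assms(3) frame_fields
  by (simp add: algebra_simps)

lemma riemann_frame2:
  assumes "vector_field M W u" "vector_field M W v" "vector_field M W w" "vector_field M W z" "p \<in> W"
  shows "riemann M g nabla u v w z p = ip g v k p * riemann M g nabla u k w z p +
    ip g v x p * riemann M g nabla u x w z p + ip g v y p * riemann M g nabla u y w z p"
  using riemann_frame4[OF assms(3,4,1,2,5)] riemann_pair_symmetry[OF W assms(1) _ assms(3,4,5)] assms(2) frame_fields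
  by simp

end

end

section \<open>Principal unit fields\<close>

context riemannian_3mfd
begin

context
  fixes W k x y
  assumes W: "openin (mtop M) W" and frame: "orthonormal_frame M g W [k, x, y]"
begin

private lemmas fields = frame_fields[OF W frame]
private lemmas products = frame_products[OF W frame]
private lemmas nabla_vf = nabla_field[OF W]

text \<open>The connection matrix of an orthonormal frame is skew.\<close>

lemma frame_rotation:
  assumes u: "vector_field M W u" and p: "p \<in> W"
  shows "ip g (nabla u k) k p = 0" "ip g (nabla u x) x p = 0" "ip g (nabla u y) y p = 0"
    and "ip g (nabla u x) k p = - ip g (nabla u k) x p" "ip g (nabla u y) k p = - ip g (nabla u k) y p"
    and "ip g (nabla u y) x p = - ip g (nabla u x) y p"
proof -
  have e: "ip g (nabla u b) a p = - ip g (nabla u a) b p"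
    if "vector_field M W a" "vector_field M W b" "\<And>q. q \<in> W \<Longrightarrow> ip g a b q = c" for a b c
    using constant_product[OF W u that(1,2) p that(3)] ip_sym[OF W that(1) nabla_vf[OF u that(2)] p] by simp
  show "ip g (nabla u k) k p = 0" "ip g (nabla u x) x p = 0" "ip g (nabla u y) y p = 0"
    using e[OF fields(1,1) products(1)] e[OF fields(2,2) products(2)] e[OF fields(3,3) products(3)] by simp_all
  show "ip g (nabla u x) k p = - ip g (nabla u k) x p" "ip g (nabla u y) k p = - ip g (nabla u k) y p"
    "ip g (nabla u y) x p = - ip g (nabla u x) y p"
    using e[OF fields(1,2) products(4)] e[OF fields(1,3) products(6)] e[OF fields(2,3) products(8)] by blast+
qed

text \<open>The remaining components, those along \<open>k\<close>, vanish because \<open>k\<close> has constant length.\<close>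

lemma parallel_if_components_vanish:
  assumes p: "p \<in> W"
    and "ip g (nabla k k) x p = 0" "ip g (nabla k k) y p = 0"
    and "ip g (nabla x k) x p = 0" "ip g (nabla x k) y p = 0"
    and "ip g (nabla y k) x p = 0" "ip g (nabla y k) y p = 0"
    and u: "vector_field M W u"
  shows "nabla u k p = 0"
proof (rule frame_zero[OF W frame nabla_vf[OF u fields(1)] p])
  show "ip g (nabla u k) k p = 0" by (rule frame_rotation(1)[OF u p])
  show "ip g (nabla u k) x p = 0" "ip g (nabla u k) y p = 0"
    using nabla_frame[OF W frame u fields(1) _ p] fields assms by simp_all
qed

lemma bracket_product:
  assumes "vector_field M W u" "vector_field M W v" "vector_field M W w" "p \<in> W"
  shows "ip g (bracket M u v) w p = ip g (nabla u v) w p - ip g (nabla v u) w p"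
proof -
  have "ip g (bracket M u v) w p = ip g (nabla u v - nabla v u) w p"
    using torsion_free[OF W assms(1,2,4)] by (simp add: ip_def)
  then show ?thesis
    using ip_diff_left[OF W nabla_vf[OF assms(1,2)] nabla_vf[OF assms(2,1)] assms(3,4)] by simp
qed

lemma dird_sum_zero:
  assumes u: "vector_field M W u" and "smooth_fun M W f" "smooth_fun M W h" and p: "p \<in> W"
    and "\<And>q. q \<in> W \<Longrightarrow> f q + h q = 0"
  shows "dird u f p + dird u h p = 0"
proof -
  have "dird u f p + dird u h p = u p (\<lambda>q. f q + h q)"
    using tangent_add[OF vector_field_tangent[OF u p] smooth_nearI[OF W p assms(2)] smooth_nearI[OF W p assms(3)]]
    by (simp add: dird_def)
  also have "\<dots> = u p (\<lambda>q. 0)"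
    by (rule tangent_cong[OF vector_field_tangent[OF u p] W p assms(5)])
  finally show ?thesis
    using tangent_const[OF vector_field_tangent[OF u p] in_topspace[OF W p]] by simp
qed

context
  assumes principal: "\<And>v w z q. vector_field M W v \<Longrightarrow> vector_field M W w \<Longrightarrow> vector_field M W z \<Longrightarrow>
    q \<in> W \<Longrightarrow> riemann M g nabla k v w z q = 0"
begin

text \<open>Pair symmetry carries the hypothesis from the first slot to the last two.\<close>

lemma principal_slots:
  assumes "vector_field M W v" "vector_field M W w" "vector_field M W z" "q \<in> W"
  shows "riemann M g nabla v k w z q = 0" "riemann M g nabla v w k z q = 0" "riemann M g nabla v w z k q = 0"
  using principal[OF assms] principal[OF assms(3,1,2,4)]
    riemann_skew12[OF W fields(1) assms] riemann_pair_symmetry[OF W fields(1) assms(3,1,2,4)]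
    riemann_skew34[OF W assms(1,2) fields(1) assms(3,4)]
  by simp_all

lemma principal_curvature:
  assumes "vector_field M W v" "vector_field M W w" "q \<in> W"
  shows "curvature k v w q = 0" "curvature v k w q = 0" "curvature v w k q = 0"
proof -
  have z: "curvature a b c q = 0"
    if "vector_field M W a" "vector_field M W b" "vector_field M W c"
      "\<And>z. vector_field M W z \<Longrightarrow> riemann M g nabla a b c z q = 0" for a b c
    using frame_zero[OF W frame curvature_field[OF W that(1-3)] assms(3)] that(4) fields
    by (simp add: riemann_curvature[OF W])
  show "curvature k v w q = 0" "curvature v k w q = 0" "curvature v w k q = 0"
    using z fields assms principal principal_slots by simp_all
qed

text \<open>Only the plane \<open>x, y\<close> contributes to the scalar curvature; it is counted twice.\<close>

lemma principal_sectional_curvature: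
  assumes q: "q \<in> W" and s: "has_scalar_curvature M g nabla q c"
  shows "riemann M g nabla x y y x q = c / 2" "riemann M g nabla x y x y q = - c / 2"
    "riemann M g nabla y x y x q = - c / 2"
    and "vector_field M W w \<Longrightarrow> vector_field M W z \<Longrightarrow> riemann M g nabla x x w z q = 0"
    and "vector_field M W w \<Longrightarrow> vector_field M W z \<Longrightarrow> riemann M g nabla y y w z q = 0"
    and "vector_field M W w \<Longrightarrow> vector_field M W z \<Longrightarrow> riemann M g nabla w z x x q = 0"
    and "vector_field M W w \<Longrightarrow> vector_field M W z \<Longrightarrow> riemann M g nabla w z y y q = 0"
proof -
  show xx: "riemann M g nabla x x w z q = 0" "riemann M g nabla y y w z q = 0"
    "riemann M g nabla w z x x q = 0" "riemann M g nabla w z y y q = 0"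
    if "vector_field M W w" "vector_field M W z" for w z
    using riemann_skew12[OF W fields(2,2) that q] riemann_skew12[OF W fields(3,3) that q]
      riemann_skew34[OF W that fields(2,2) q] riemann_skew34[OF W that fields(3,3) q] by simp_all
  note sk = riemann_skew34[OF W fields(2,3,3,2) q] riemann_skew12[OF W fields(2,3,3,2) q]
    riemann_skew12[OF W fields(2,3,2,3) q]
  have "(\<Sum>i<DIM(real^3). \<Sum>j<DIM(real^3).
      riemann M g nabla ([k, x, y] ! i) ([k, x, y] ! j) ([k, x, y] ! j) ([k, x, y] ! i) q) = c"
    using s W q frame unfolding has_scalar_curvature_def by blast
  then have "riemann M g nabla x y y x q + riemann M g nabla y x x y q = c"
    using fields q by (simp add: numeral_3_eq_3 principal principal_slots xx)
  then show "riemann M g nabla x y y x q = c / 2" "riemann M g nabla x y x y q = - c / 2"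
    "riemann M g nabla y x y x q = - c / 2"
    using sk by simp_all
qed

context
  fixes c
  assumes c: "c \<noteq> 0" and scalar: "\<And>q. q \<in> W \<Longrightarrow> has_scalar_curvature M g nabla q c"
begin

text \<open>The integral curves of \<open>k\<close> are geodesics: the second Bianchi identity on \<open>k, x, y\<close> applied to
  \<open>k\<close> reduces to \<open>R(x, y) \<nabla>\<^sub>k k = 0\<close>, and \<open>R(x, y)\<close> is invertible on the plane orthogonal to \<open>k\<close>.\<close>

lemma principal_geodesic:
  assumes p: "p \<in> W"
  shows "nabla k k p = 0"
proof -
  note K = principal_sectional_curvature[OF p scalar[OF p]]
  have N: "vector_field M W (nabla k k)" using nabla_vf fields by blast
  note b = bracket_field[OF W]
  have n0: "nabla k (curvature x y k) p = 0" "nabla x (curvature y k k) p = 0" "nabla y (curvature k x k) p = 0"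
    by (rule nabla_zero[OF W _ _ p]; use fields principal_curvature in \<open>simp add: curvature_field[OF W]\<close>)+
  have "curvature x y (nabla k k) p = 0"
    using second_bianchi[OF W fields fields(1) p] n0 principal_curvature p fields
    by (simp add: b nabla_vf)
  then have "riemann M g nabla x y (nabla k k) e p = 0" if "vector_field M W e" for e
    using ip_zero[OF W that p] by (simp add: riemann_curvature[OF W])
  then have "riemann M g nabla x y (nabla k k) x p = 0" "riemann M g nabla x y (nabla k k) y p = 0"
    using fields by blast+
  then have "ip g (nabla k k) y p * (c / 2) = 0" "ip g (nabla k k) x p * (- c / 2) = 0"
    using riemann_frame3[OF W frame fields(2,3) N fields(2) p] riemann_frame3[OF W frame fields(2,3) N fields(3) p]
      K(1-3) K(6,7)[OF fields(2,3)] principal_slots fields p by simp_all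
  then show ?thesis
    using c frame_zero[OF W frame N p frame_rotation(1)[OF fields(1) p]] by simp
qed

text \<open>The divergence of \<open>k\<close> vanishes: in the second Bianchi identity on \<open>k, x, y\<close> applied to \<open>y\<close>, the
  derivative of the constant sectional curvature drops out and what remains is the divergence times
  that curvature.\<close>

lemma principal_divergence:
  assumes p: "p \<in> W"
  shows "ip g (nabla x k) x p + ip g (nabla y k) y p = 0"
proof -
  note K = principal_sectional_curvature[OF p scalar[OF p]]
  note b = bracket_field[OF W]
  note cf = curvature_field[OF W]
  have n0: "nabla x (curvature y k y) p = 0" "nabla y (curvature k x y) p = 0"
    by (rule nabla_zero[OF W _ _ p]; use fields principal_curvature in \<open>simp add: cf\<close>)+
  let ?A = "nabla k (curvature x y y)" and ?B = "curvature x y (nabla k y)"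
    and ?C = "curvature x (bracket M y k) y" and ?D = "curvature y (bracket M k x) y"
  have vf: "vector_field M W ?A" "vector_field M W ?B" "vector_field M W ?C" "vector_field M W ?D"
    using fields b nabla_vf cf by auto
  have "(?A - ?B + ?C + ?D) p = 0"
    using second_bianchi[OF W fields fields(3) p] n0 principal_curvature p fields
    by (simp add: b nabla_vf)
  then have "ip g (?A - ?B + ?C + ?D) x p = 0"
    by (rule ip_zero[OF W fields(2) p])
  then have sum: "ip g ?A x p - ip g ?B x p + ip g ?C x p + ip g ?D x p = 0"
    using vf fields p by (simp add: ip_add_left[OF W] ip_diff_left[OF W] vector_field_add vector_field_diff[OF W])
  \<comment> \<open>The only derivative of curvature, and it is that of the constant \<open>c / 2\<close>.\<close>
  have "ip g ?A x p + ip g (curvature x y y) (nabla k x) p = 0"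
    by (rule constant_product[OF W fields(1) cf[OF fields(2,3,3)] fields(2) p, where c = "c / 2"])
      (use principal_sectional_curvature(1)[OF _ scalar] in \<open>simp add: riemann_curvature[OF W]\<close>)
  moreover have "ip g (curvature x y y) (nabla k x) p = 0"
    using riemann_frame4[OF W frame fields(2,3,3) nabla_vf[OF fields(1,2)] p] K(7)[OF fields(2,3)]
      principal_slots(3)[OF fields(2,3,3) p] frame_rotation(2)[OF fields(1) p]
    by (simp add: riemann_curvature[OF W])
  ultimately have A: "ip g ?A x p = 0" by simp
  have B: "ip g ?B x p = 0"
    using riemann_frame3[OF W frame fields(2,3) nabla_vf[OF fields(1,3)] fields(2) p] K(6)[OF fields(2,3)]
      principal_slots(2)[OF fields(2,3,2) p] frame_rotation(3)[OF fields(1) p]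
    by (simp add: riemann_curvature[OF W])
  have "ip g ?C x p = ip g (bracket M y k) y p * (c / 2)"
    using riemann_frame2[OF W frame fields(2) b[OF fields(3,1)] fields(3,2) p] K(1) K(4)[OF fields(3,2)]
      principal_slots(1)[OF fields(2,3,2) p]
    by (simp add: riemann_curvature[OF W])
  then have C: "ip g ?C x p = ip g (nabla y k) y p * (c / 2)"
    using bracket_product[OF fields(3,1,3) p] frame_rotation(3)[OF fields(1) p] by simp
  have "ip g ?D x p = ip g (bracket M k x) x p * (- c / 2)"
    using riemann_frame2[OF W frame fields(3) b[OF fields(1,2)] fields(3,2) p] K(3) K(5)[OF fields(3,2)]
      principal_slots(1)[OF fields(3,3,2) p]
    by (simp add: riemann_curvature[OF W])
  then have D: "ip g ?D x p = ip g (nabla x k) x p * (c / 2)"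
    using bracket_product[OF fields(1,2,2) p] frame_rotation(2)[OF fields(1) p] by simp
  have "(ip g (nabla x k) x p + ip g (nabla y k) y p) * (c / 2) = 0"
    using sum unfolding A B C D by (simp add: algebra_simps)
  then show ?thesis using c by simp
qed

text \<open>One diagonal entry of the Riccati equation \<open>\<nabla>\<^sub>k D = - D\<^sup>2\<close> for the endomorphism \<open>D u = \<nabla>\<^sub>u k\<close>,
  which is \<open>R(k, x) k = 0\<close> for a geodesic field \<open>k\<close>. The term with \<open>\<nabla>\<^sub>k x\<close> accounts for the rotation of
  the frame and cancels in the trace.\<close>

lemma principal_riccati:
  assumes p: "p \<in> W" and twist: "ip g (nabla y k) x p = ip g (nabla x k) y p"
  shows "dird k (ip g (nabla x k) x) p =
    2 * ip g (nabla k x) y p * ip g (nabla x k) y p - (ip g (nabla x k) x p)\<^sup>2 - (ip g (nabla x k) y p)\<^sup>2"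
proof -
  have vf: "vector_field M W (nabla k x)" "vector_field M W (nabla x k)" "vector_field M W (nabla k k)"
    "vector_field M W (bracket M k x)" "vector_field M W (nabla k (nabla x k))"
    "vector_field M W (nabla (bracket M k x) k)"
    using fields nabla_vf bracket_field[OF W] by auto
  have "nabla x (nabla k k) p = 0"
    by (rule nabla_zero[OF W fields(2) vf(3) p]) (simp add: principal_geodesic)
  then have "(nabla k (nabla x k) - nabla (bracket M k x) k) p = 0"
    using principal_curvature(1)[OF fields(2,1) p] by (simp add: curvature_apply[OF W])
  then have "ip g (nabla k (nabla x k) - nabla (bracket M k x) k) x p = 0"
    by (rule ip_zero[OF W fields(2) p])
  then have eq: "ip g (nabla k (nabla x k)) x p = ip g (nabla (bracket M k x) k) x p"
    using vf fields p by (simp add: ip_diff_left[OF W])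
  have "ip g (nabla (bracket M k x) k) x p = ip g (bracket M k x) x p * ip g (nabla x k) x p
      + ip g (bracket M k x) y p * ip g (nabla y k) x p"
    using nabla_frame[OF W frame vf(4) fields(1,2) p] ip_zero[where u = "nabla k k", OF W fields(2) p principal_geodesic[OF p]] by simp
  moreover have "ip g (bracket M k x) x p = - ip g (nabla x k) x p"
    using bracket_product[OF fields(1,2,2) p] frame_rotation(2)[OF fields(1) p] by simp
  moreover have "ip g (bracket M k x) y p = ip g (nabla k x) y p - ip g (nabla x k) y p"
    using bracket_product[OF fields(1,2,3) p] .
  moreover have "ip g (nabla x k) (nabla k x) p = ip g (nabla x k) y p * ip g (nabla k x) y p"
    using parseval[OF W frame vf(2,1) p] frame_rotation(1)[OF fields(2) p] frame_rotation(2)[OF fields(1) p] by simp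
  moreover have "dird k (ip g (nabla x k) x) p = ip g (nabla k (nabla x k)) x p + ip g (nabla x k) (nabla k x) p"
    by (rule metric_compatible[OF W fields(1) vf(2) fields(2) p])
  ultimately show ?thesis
    using eq twist by (simp add: power2_eq_square algebra_simps)
qed

end

end

end

text \<open>The trace of the Riccati equation: the divergence vanishes, hence so does the squared norm of the
  symmetric endomorphism \<open>u \<mapsto> \<nabla>\<^sub>u k\<close>.\<close>

lemma principal_imp_parallel:
  assumes W: "openin (mtop M) W" and frame: "orthonormal_frame M g W [k, x, y]"
    and principal: "\<And>v w z q. vector_field M W v \<Longrightarrow> vector_field M W w \<Longrightarrow> vector_field M W z \<Longrightarrow>
      q \<in> W \<Longrightarrow> riemann M g nabla k v w z q = 0"
    and c: "c \<noteq> 0" and scalar: "\<And>q. q \<in> W \<Longrightarrow> has_scalar_curvature M g nabla q c"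
    and twist: "\<And>q. q \<in> W \<Longrightarrow> ip g (nabla y k) x q = ip g (nabla x k) y q"
    and p: "p \<in> W" and u: "vector_field M W u"
  shows "nabla u k p = 0"
proof -
  note swap = frame_swap[OF W frame]
  note fields = frame_fields[OF W frame]
  let ?a = "ip g (nabla x k) x" and ?b = "ip g (nabla y k) y" and ?s = "ip g (nabla x k) y p"
  have "dird k ?a p + dird k ?b p = 0"
    by (rule dird_sum_zero[OF W frame fields(1)])
      (use fields p principal_divergence[OF W frame principal c scalar] in
        \<open>simp_all add: ip_smooth[OF W] nabla_field[OF W]\<close>)
  moreover have "dird k ?a p = 2 * ip g (nabla k x) y p * ?s - (?a p)\<^sup>2 - ?s\<^sup>2"
    by (rule principal_riccati[OF W frame principal c scalar p twist[OF p]])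
  moreover have "dird k ?b p = - 2 * ip g (nabla k x) y p * ?s - (?b p)\<^sup>2 - ?s\<^sup>2"
    using principal_riccati[OF W swap principal c scalar p twist[OF p, symmetric]]
      frame_rotation(6)[OF W frame fields(1) p] twist[OF p] by simp
  ultimately have "(?a p)\<^sup>2 + (?b p)\<^sup>2 + 2 * ?s\<^sup>2 = 0" by simp
  then have "(?a p)\<^sup>2 = 0" "(?b p)\<^sup>2 = 0" "?s\<^sup>2 = 0"
    using zero_le_power2[of "?a p"] zero_le_power2[of "?b p"] zero_le_power2[of ?s] by linarith+
  moreover have "ip g (nabla k k) e p = 0" if "vector_field M W e" for e
    using ip_zero[where u = "nabla k k", OF W that p principal_geodesic[OF W frame principal c scalar p]] .
  ultimately show ?thesis
    using parallel_if_components_vanish[OF W frame p _ _ _ _ _ _ u] fields twist[OF p] by simp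
qed

lemma killing_imp_parallel:
  assumes W: "openin (mtop M) W" and frame: "orthonormal_frame M g W [k, x, y]"
    and skew: "\<And>u v. vector_field M W u \<Longrightarrow> vector_field M W v \<Longrightarrow>
      ip g (nabla u k) v p + ip g u (nabla v k) p = 0"
    and twist: "ip g (nabla y k) x p = ip g (nabla x k) y p"
    and p: "p \<in> W" and u: "vector_field M W u"
  shows "nabla u k p = 0"
proof -
  note fields = frame_fields[OF W frame]
  have s: "ip g (nabla v k) u p = - ip g (nabla u k) v p" if "vector_field M W u" "vector_field M W v" for u v
    using skew[OF that] ip_sym[OF W that(1) nabla_field[OF W that(2) fields(1)] p] by simp
  show ?thesis
    using parallel_if_components_vanish[OF W frame p _ _ _ _ _ _ u]
      s[OF fields(1,2)] s[OF fields(1,3)] s[OF fields(2,2)] s[OF fields(3,3)] s[OF fields(2,3)] twist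
      frame_rotation(1)[OF W frame fields(2) p] frame_rotation(1)[OF W frame fields(3) p]
    by simp
qed

text \<open>For parallel \<open>k\<close> every term of \<open>R(w, z) k\<close> is zero, and pair symmetry moves \<open>k\<close> into the first slot.\<close>

lemma parallel_imp_principal:
  assumes W: "openin (mtop M) W" and k: "vector_field M W k"
    and par: "\<And>u q. vector_field M W u \<Longrightarrow> q \<in> W \<Longrightarrow> nabla u k q = 0"
    and v: "vector_field M W v" and w: "vector_field M W w" and z: "vector_field M W z" and p: "p \<in> W"
  shows "riemann M g nabla k v w z p = 0"
proof -
  have "nabla w (nabla z k) p = 0" "nabla z (nabla w k) p = 0"
    using nabla_zero[OF W w nabla_field[OF W z k] p] nabla_zero[OF W z nabla_field[OF W w k] p] par w z by auto
  then have "curvature w z k p = 0"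
    using par[OF bracket_field[OF W w z] p] by (simp add: curvature_apply[OF W])
  then have "riemann M g nabla w z k v p = 0"
    using ip_zero[OF W v p] by (simp add: riemann_curvature[OF W])
  then show ?thesis using riemann_pair_symmetry[OF W k v w z p] by simp
qed

end

text \<open>Frames exist only locally, so both directions are argued near a given point, on an open set that
  carries a frame completing \<open>k\<close>; connection, curvature and Lie derivative see germs only.\<close>

theorem corollary3:
  fixes M :: "('a, real^3) manifold"
    and g :: "'a metric_tensor"
    and nabla :: "'a connection"
    and c :: real
    and U :: "'a set"
    and k :: "'a vfield"
  assumes "smooth_manifold M"
    and "riemannian_metric M g"
    and "levi_civita M g nabla"
    and "c \<noteq> 0"
    and "\<And>p. p \<in> topspace (mtop M) \<Longrightarrow> has_scalar_curvature M g nabla p c"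
    and "openin (mtop M) U"
    and "unit_vector_field M g U k"
    and "hypersurface_orthogonal M g nabla U k"
  shows "two_principal M g nabla U k \<longleftrightarrow> killing M g U k"
proof -
  interpret riemannian_3mfd M g nabla
    by unfold_locales (rule assms)+
  have k: "vector_field M U k" using assms(7) by (simp add: unit_vector_field_def)
  have near: "\<exists>V x y. openin (mtop M) V \<and> p \<in> V \<and> V \<subseteq> W \<and> V \<subseteq> U \<and> orthonormal_frame M g V [k, x, y] \<and>
      (\<forall>q\<in>V. ip g (nabla y k) x q = ip g (nabla x k) y q)"
    if W: "openin (mtop M) W" "W \<subseteq> U" and p: "p \<in> W" for W p
  proof -
    have "unit_vector_field M g W k"
      using assms(7) W(2) vector_field_subset[OF k W(2)] by (auto simp: unit_vector_field_def)
    then obtain V x y where V: "openin (mtop M) V" "p \<in> V" "V \<subseteq> W" "orthonormal_frame M g V [k, x, y]"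
      using orthonormal_frame_exists[OF W(1) _ p] by blast
    moreover have "V \<subseteq> U" using V(3) W(2) by blast
    ultimately show ?thesis
      using assms(8) unfolding hypersurface_orthogonal_def by (metis eq_iff_diff_eq_0)
  qed
  show ?thesis
  proof
    assume pr: "two_principal M g nabla U k"
    show "killing M g U k"
      unfolding killing_def
    proof (intro allI impI ballI)
      fix W u v p
      assume W: "openin (mtop M) W" "W \<subseteq> U" and u: "vector_field M W u" and v: "vector_field M W v" and p: "p \<in> W"
      obtain V x y where V: "openin (mtop M) V" "p \<in> V" "V \<subseteq> W" "V \<subseteq> U" "orthonormal_frame M g V [k, x, y]"
        and twist: "\<And>q. q \<in> V \<Longrightarrow> ip g (nabla y k) x q = ip g (nabla x k) y q"
        using near[OF W p] by blast
      have u': "vector_field M V u" and v': "vector_field M V v"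
        using u v V(3) vector_field_subset by blast+
      have par: "nabla w k p = 0" if w: "vector_field M V w" for w
      proof (rule principal_imp_parallel[OF V(1,5) _ assms(4) _ twist V(2) w])
        show "riemann M g nabla k v w z q = 0"
          if "vector_field M V v" "vector_field M V w" "vector_field M V z" "q \<in> V" for v w z q
          using pr that V(1,4) unfolding two_principal_def by blast
        show "has_scalar_curvature M g nabla q c" if "q \<in> V" for q
          using assms(5)[OF in_topspace[OF V(1) that]] .
      qed
      have kV: "vector_field M V k" by (rule vector_field_subset[OF k V(4)])
      have "ip g (nabla u k) v p = 0" "ip g u (nabla v k) p = 0"
        using ip_zero[where u = "nabla u k", OF V(1) v' V(2) par[OF u']]
          ip_zero[where u = "nabla v k", OF V(1) u' V(2) par[OF v']]
          ip_sym[OF V(1) u' nabla_field[OF V(1) v' kV] V(2)] by simp_all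
      then show "dird k (ip g u v) p - ip g (bracket M k u) v p - ip g u (bracket M k v) p = 0"
        using lie_derivative_metric[OF V(1) kV u' v' V(2)] by simp
    qed
  next
    assume ki: "killing M g U k"
    show "two_principal M g nabla U k"
      unfolding two_principal_def
    proof (intro allI impI ballI)
      fix W v w z p
      assume W: "openin (mtop M) W" "W \<subseteq> U" and vf: "vector_field M W v" "vector_field M W w" "vector_field M W z"
        and p: "p \<in> W"
      obtain V x y where V: "openin (mtop M) V" "p \<in> V" "V \<subseteq> W" "V \<subseteq> U" "orthonormal_frame M g V [k, x, y]"
        and twist: "\<And>q. q \<in> V \<Longrightarrow> ip g (nabla y k) x q = ip g (nabla x k) y q"
        using near[OF W p] by blast
      have kV: "vector_field M V k" by (rule vector_field_subset[OF k V(4)])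
      have skew: "ip g (nabla a k) b q + ip g a (nabla b k) q = 0"
        if "vector_field M V a" "vector_field M V b" "q \<in> V" for a b q
      proof -
        have "dird k (ip g a b) q - ip g (bracket M k a) b q - ip g a (bracket M k b) q = 0"
          using ki V(1,4) that unfolding killing_def by blast
        then show ?thesis using lie_derivative_metric[OF V(1) kV that] by simp
      qed
      have "nabla u k q = 0" if "vector_field M V u" "q \<in> V" for u q
        using killing_imp_parallel[OF V(1,5) skew twist] that by blast
      then show "riemann M g nabla k v w z p = 0"
        using parallel_imp_principal[OF V(1) kV] vf V(2,3) vector_field_subset by metis
    qed
  qed
qed

end
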